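(* Let $n\ge 2$. For every $R>0$ there exist rotationally symmetric graphical solutions to mean curvature flow $W^+_R, W^-_R:(\mathbb{R}^n\setminus B_R)\times[0,\infty)\to\mathbb{R}$, translating with speed $1$, and constants $C^+,C^-\in\mathbb{R}$ such that, with $r=|x|$, as $r\to\infty$, $$W^\pm_R(r,t)=t+\frac{r^2}{2(n-1)}-\ln r+O(r^{-1})+C^\pm .$$ Moreover, the union of the graphs of $W^+_R$ and $W^-_R$ forms a complete non-convex translating solution to mean curvature flow.
   Context: $B_R$ is the ball of radius $R$ about the origin in $\mathbb{R}^n$. Graphical mean curvature flow for a function $u(x,t)$ is the equation $$\dot u=\sqrt{1+|\nabla u|^2}\,\operatorname{div}\left(\frac{\nabla u}{\sqrt{1+|\nabla u|^2}}\right).$$ The functions $W^\pm_R$ satisfy this equation for $|x|>R$; their gradients become unbounded as $|x|\downarrow R$ and the two graphs meet along the sphere $|x|=R$. "Rotationally symmetric" means depending only on $|x|$ and $t$ (so one writes $W(r,t)=W(x,t)$ with $r=|x|$); "translating with speed $1$" means $W(x,t)=W(x,0)+t$. A translating solution to mean curvature flow (as a hypersurface) is a family of hypersurfaces $M_t=M_0+t\,e_{n+1}$ in $\mathbb{R}^{n+1}$ whose normal velocity equals the mean curvature vector, i.e. the mean curvature vector of $M_0$ is the normal component of $e_{n+1}$. Here $M_t$ is the union of the graphs of $W^+_R(\cdot,t)$ and $W^-_R(\cdot,t)$. *)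

theory Defs
  imports "HOL-Analysis.Analysis" "HOL-Library.Landau_Symbols"
begin

text \<open>Meaningful only at points of differentiability, as \<open>frechet_derivative\<close> is arbitrary elsewhere.\<close>

definition grad :: "('a::euclidean_space \<Rightarrow> real) \<Rightarrow> 'a \<Rightarrow> 'a" where
  "grad f x = (\<Sum>b\<in>Basis. frechet_derivative f (at x) b *\<^sub>R b)"

definition divergence :: "('a::euclidean_space \<Rightarrow> 'a) \<Rightarrow> 'a \<Rightarrow> real" where
  "divergence X x = (\<Sum>b\<in>Basis. frechet_derivative X (at x) b \<bullet> b)"

text \<open>\<open>Ck_on k S f\<close> is used for open \<open>S\<close> only: all iterated directional derivatives of
  order less than \<open>k\<close> are differentiable on \<open>S\<close>, and those of order \<open>k\<close> are continuous.\<close>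

primrec Ck_on :: "nat \<Rightarrow> 'a::real_normed_vector set \<Rightarrow> ('a \<Rightarrow> 'b::real_normed_vector) \<Rightarrow> bool" where
  "Ck_on 0 S f \<longleftrightarrow> continuous_on S f"
| "Ck_on (Suc k) S f \<longleftrightarrow> (\<forall>x\<in>S. f differentiable (at x)) \<and>
     (\<forall>v. Ck_on k S (\<lambda>x. frechet_derivative f (at x) v))"

definition smooth_on :: "'a::real_normed_vector set \<Rightarrow> ('a \<Rightarrow> 'b::real_normed_vector) \<Rightarrow> bool" where
  "smooth_on S f \<longleftrightarrow> (\<forall>k. Ck_on k S f)"

text \<open>Smoothness on \<open>\<Omega> \<times> [0,\<infinity>)\<close>, up to and including the initial time, is expressed by a
  smooth extension to the open set \<open>\<Omega> \<times> \<real>\<close>. At \<open>t = 0\<close> the time derivative is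
  one-sided.\<close>

definition graphical_mcf_on :: "'a::euclidean_space set \<Rightarrow> ('a \<Rightarrow> real \<Rightarrow> real) \<Rightarrow> bool" where
  "graphical_mcf_on \<Omega> u \<longleftrightarrow> open \<Omega> \<and>
     (\<exists>v. smooth_on (\<Omega> \<times> UNIV) v \<and> (\<forall>x\<in>\<Omega>. \<forall>t\<ge>0. v (x, t) = u x t)) \<and>
     (\<forall>x\<in>\<Omega>. \<forall>t\<ge>0.
        (u x has_real_derivative
           sqrt (1 + (norm (grad (\<lambda>z. u z t) x))\<^sup>2) *
           divergence (\<lambda>y. grad (\<lambda>z. u z t) y /\<^sub>R sqrt (1 + (norm (grad (\<lambda>z. u z t) y))\<^sup>2)) x)
        (at t within {0..}))"

definition rotationally_symmetric_on ::
    "'a::real_normed_vector set \<Rightarrow> ('a \<Rightarrow> real \<Rightarrow> real) \<Rightarrow> bool" where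
  "rotationally_symmetric_on S u \<longleftrightarrow>
     (\<forall>x\<in>S. \<forall>y\<in>S. \<forall>t\<ge>0. norm x = norm y \<longrightarrow> u x t = u y t)"

definition translating_with_unit_speed_on :: "'a set \<Rightarrow> ('a \<Rightarrow> real \<Rightarrow> real) \<Rightarrow> bool" where
  "translating_with_unit_speed_on S u \<longleftrightarrow> (\<forall>x\<in>S. \<forall>t\<ge>0. u x t = u x 0 + t)"

definition graph_over :: "'a set \<Rightarrow> ('a \<Rightarrow> real) \<Rightarrow> ('a \<times> real) set" where
  "graph_over S f = (\<lambda>x. (x, f x)) ` S"

definition local_equation ::
    "'a::euclidean_space set \<Rightarrow> 'a set \<Rightarrow> ('a \<Rightarrow> real) \<Rightarrow> bool" where
  "local_equation M U F \<longleftrightarrow> open U \<and> smooth_on U F \<and>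
     M \<inter> U = {q \<in> U. F q = 0} \<and> (\<forall>q\<in>U. grad F q \<noteq> 0)"

definition smooth_hypersurface :: "'a::euclidean_space set \<Rightarrow> bool" where
  "smooth_hypersurface M \<longleftrightarrow> (\<forall>p\<in>M. \<exists>U F. p \<in> U \<and> local_equation M U F)"

text \<open>For a local equation \<open>F\<close> of \<open>M\<close> on \<open>U\<close>, this is a unit normal field of
  \<open>M\<close>, extended to a unit vector field on \<open>U\<close>. On \<open>M \<inter> U\<close> it depends on
  \<open>F\<close> only up to sign.\<close>

definition unit_normal :: "('a::euclidean_space \<Rightarrow> real) \<Rightarrow> 'a \<Rightarrow> 'a" where
  "unit_normal F q = grad F q /\<^sub>R norm (grad F q)"

text \<open>To be applied to tangent vectors \<open>v\<close>, \<open>w\<close> of \<open>M\<close> at \<open>p\<close>, that is, vectors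
  orthogonal to \<open>unit_normal F p\<close>.\<close>

definition second_fundamental_form ::
    "('a::euclidean_space \<Rightarrow> real) \<Rightarrow> 'a \<Rightarrow> 'a \<Rightarrow> 'a \<Rightarrow> real" where
  "second_fundamental_form F p v w = frechet_derivative (unit_normal F) (at p) v \<bullet> w"

text \<open>The trace of the second fundamental form over the tangent space is the full ambient
  divergence of \<open>N = unit_normal F\<close>, because \<open>\<bar>N\<bar> = 1\<close> near \<open>p\<close> gives
  \<open>D\<^sub>N N \<bullet> N = 0\<close>. The resulting vector does not depend on the choice of \<open>F\<close>.\<close>

definition has_mean_curvature_vector ::
    "'a::euclidean_space set \<Rightarrow> 'a \<Rightarrow> 'a \<Rightarrow> bool" where
  "has_mean_curvature_vector M p H \<longleftrightarrow>
     (\<exists>U F. p \<in> U \<and> local_equation M U F \<and>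
        H = - (divergence (unit_normal F) p) *\<^sub>R unit_normal F p)"

definition is_normal_component ::
    "'a::euclidean_space set \<Rightarrow> 'a \<Rightarrow> 'a \<Rightarrow> 'a \<Rightarrow> bool" where
  "is_normal_component M p e w \<longleftrightarrow>
     (\<exists>U F. p \<in> U \<and> local_equation M U F \<and>
        w = (e \<bullet> unit_normal F p) *\<^sub>R unit_normal F p)"

text \<open>\<open>M\<^sub>t = M\<^sub>0 + t e\<close> for the last basis vector \<open>e\<close>, and the mean curvature vector
  of \<open>M\<^sub>0\<close> is the normal component of \<open>e\<close>.\<close>

definition translating_mcf_solution ::
    "(real \<Rightarrow> ('a::euclidean_space \<times> real) set) \<Rightarrow> bool" where
  "translating_mcf_solution M \<longleftrightarrow>
     smooth_hypersurface (M 0) \<and>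
     (\<forall>t\<ge>0. M t = (\<lambda>p. p + t *\<^sub>R (0, 1)) ` M 0) \<and>
     (\<forall>p\<in>M 0. \<exists>H. has_mean_curvature_vector (M 0) p H \<and> is_normal_component (M 0) p (0, 1) H)"

text \<open>Convexity of a hypersurface is the differential-geometric one, not convexity as a point set:
  at each point the principal curvatures are all nonnegative for one of the two choices of the
  unit normal. Boundaries of convex sets have this property.\<close>

definition convex_hypersurface :: "'a::euclidean_space set \<Rightarrow> bool" where
  "convex_hypersurface M \<longleftrightarrow> smooth_hypersurface M \<and>
     (\<forall>p\<in>M. \<forall>U F. p \<in> U \<and> local_equation M U F \<longrightarrow>
        (\<forall>v. v \<bullet> unit_normal F p = 0 \<longrightarrow> second_fundamental_form F p v v \<ge> 0) \<or>
        (\<forall>v. v \<bullet> unit_normal F p = 0 \<longrightarrow> second_fundamental_form F p v v \<le> 0))"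

text \<open>Valid paths are only piecewise \<open>C\<^sup>1\<close> with a derivative that may be unbounded near the
  break points; the nonnegative Lebesgue integral then correctly gives length \<open>\<infinity>\<close> if the
  path is not rectifiable. The infimum is \<open>\<infinity>\<close> for points in different components.\<close>

definition path_length :: "(real \<Rightarrow> 'a::euclidean_space) \<Rightarrow> ennreal" where
  "path_length \<gamma> = (\<integral>\<^sup>+ s\<in>{0..1}. ennreal (norm (vector_derivative \<gamma> (at s))) \<partial>lborel)"

definition intrinsic_dist :: "'a::euclidean_space set \<Rightarrow> 'a \<Rightarrow> 'a \<Rightarrow> ennreal" where
  "intrinsic_dist M p q =
     (INF \<gamma>\<in>{\<gamma>. valid_path \<gamma> \<and> path_image \<gamma> \<subseteq> M \<and> pathstart \<gamma> = p \<and> pathfinish \<gamma> = q}.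
        path_length \<gamma>)"

text \<open>Every Cauchy sequence for the intrinsic distance converges in \<open>M\<close>. Convergence in the
  topology of the embedded hypersurface \<open>M\<close> (the subspace topology) is the same as convergence
  for the intrinsic distance, whereas the Cauchy condition is weaker for the ambient distance, so
  this is not the library predicate \<open>complete\<close>.\<close>

definition complete_hypersurface :: "'a::euclidean_space set \<Rightarrow> bool" where
  "complete_hypersurface M \<longleftrightarrow> smooth_hypersurface M \<and>
     (\<forall>\<sigma>. range \<sigma> \<subseteq> M \<and>
        (\<forall>\<epsilon>>0. \<exists>N. \<forall>i\<ge>N. \<forall>j\<ge>N. intrinsic_dist M (\<sigma> i) (\<sigma> j) < ennreal \<epsilon>) \<longrightarrow>
        (\<exists>p\<in>M. \<sigma> \<longlonglongrightarrow> p))"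

end

theory Submission
  imports Defs
begin

text \<open>Let \<open>m = n - 1\<close>. In terms of arc length, the profile curve \<open>(r, z)\<close> of a rotationally symmetric
  translator, with tangent \<open>(cos \<theta>, sin \<theta>)\<close>, satisfies \<open>\<theta>' = cos \<theta> - m sin \<theta> / r\<close>. The solution
  through \<open>(R, 0)\<close> with vertical tangent exists for all time and attains its least radius \<open>R\<close> there,
  since on either side \<open>\<theta>\<close> stays in an interval of length \<open>\<pi>\<close> whose end points repel. The two
  halves are graphs of functions of the radius whose slope solves
  \<open>\<phi>' = (1 + \<phi>\<^sup>2) (1 - m \<phi> / r)\<close>; trapping arguments for this equation give the asymptotic expansion,
  and uniqueness makes the graphs disjoint for \<open>r > R\<close>. Near the neck the curve is instead a graph
  over the axis. The resulting hypersurface is closed, hence complete, and it has principal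
  curvatures of both signs at the neck.\<close>

section \<open>Smooth functions and differential operators\<close>

text \<open>The slope equation cannot be started at the neck, where \<open>\<phi>\<close> is
  infinite. Angle and arc length turn these data into regular ones, so a single solution crosses the
  neck and carries both wings. The number \<open>m\<close> counts the principal curvatures along the
  orbit spheres. The union has to be cut out by local equations, hence must be embedded, and this
  dictates two choices. The wings must not meet again, so their slopes are compared, and the chart
  of one wing deletes the graph of the other. The lower wing descends at first but grows
  quadratically in the end, so it returns to the height of the neck at a larger radius; the neck
  chart therefore restricts the radius as well as the height. Regularity is algebraic: each profile
  function solves an equation whose right-hand side is polynomial in the profile functions and their
  reciprocals, so first derivatives determine those of all orders.\<close>

lemma Ck_on_subset: "Ck_on k S f \<Longrightarrow> T \<subseteq> S \<Longrightarrow> Ck_on k T f"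
  by (induction k arbitrary: f) (auto intro: continuous_on_subset)

lemma smooth_on_subset: "smooth_on S f \<Longrightarrow> T \<subseteq> S \<Longrightarrow> smooth_on T f"
  unfolding smooth_on_def using Ck_on_subset by blast

text \<open>Openness matters because \<open>Ck_on\<close> uses two-sided derivatives: functions that
  agree on \<open>S\<close> then agree near each of its points.\<close>

lemma Ck_on_cong:
  assumes "open S" "\<And>x. x \<in> S \<Longrightarrow> f x = g x"
  shows "Ck_on k S f = Ck_on k S g"
  using assms(2)
proof (induction k arbitrary: f g)
  case 0
  then show ?case by (simp cong: continuous_on_cong)
next
  case (Suc k)
  have d: "f differentiable (at x) \<longleftrightarrow> g differentiable (at x)" if "x \<in> S" for x
    unfolding differentiable_def
    by (metis has_derivative_transform_within_open \<open>open S\<close> Suc.prems that)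
  have "Ck_on k S (\<lambda>x. frechet_derivative f (at x) v) =
        Ck_on k S (\<lambda>x. frechet_derivative g (at x) v)"
    if "\<forall>x\<in>S. f differentiable (at x)" for v
    using that by (intro Suc.IH) (metis frechet_derivative_transform_within_open \<open>open S\<close> Suc.prems)
  with d show ?case by auto
qed

text \<open>Division is left out on purpose. A reciprocal such as \<open>1 / norm (fst q)\<close> is
  added as a generator of its own, since its derivative is again polynomial in the
  generators.\<close>

inductive_set generated_algebra :: "('a \<Rightarrow> real) set \<Rightarrow> ('a \<Rightarrow> real) set" for G where
  const: "(\<lambda>_. a) \<in> generated_algebra G"
| gen: "f \<in> G \<Longrightarrow> f \<in> generated_algebra G"
| add: "f \<in> generated_algebra G \<Longrightarrow> g \<in> generated_algebra G \<Longrightarrow> (\<lambda>x. f x + g x) \<in> generated_algebra G"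
| mult: "f \<in> generated_algebra G \<Longrightarrow> g \<in> generated_algebra G \<Longrightarrow> (\<lambda>x. f x * g x) \<in> generated_algebra G"

lemma generated_algebra_uminus:
  "f \<in> generated_algebra G \<Longrightarrow> (\<lambda>x. - f x) \<in> generated_algebra G"
  using generated_algebra.mult[OF generated_algebra.const[of "-1"], of f] by simp

lemma generated_algebra_diff:
  "f \<in> generated_algebra G \<Longrightarrow> g \<in> generated_algebra G \<Longrightarrow> (\<lambda>x. f x - g x) \<in> generated_algebra G"
  using generated_algebra.add[OF _ generated_algebra_uminus, of f G g] by simp

lemmas generated_algebra_intros =
  generated_algebra.const generated_algebra.add generated_algebra.mult
  generated_algebra_uminus generated_algebra_diff

text \<open>Used to bootstrap smoothness from a differential equation: the generators only need to be
  differentiable, with derivatives that are polynomials in the generators.\<close>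

lemma smooth_on_generated_algebra:
  fixes G :: "('a::real_normed_vector \<Rightarrow> real) set"
  assumes "open S" "f \<in> generated_algebra G"
    and G: "\<And>g. g \<in> G \<Longrightarrow> \<exists>D. (\<forall>x\<in>S. (g has_derivative D x) (at x)) \<and>
                    (\<forall>v. (\<lambda>x. D x v) \<in> generated_algebra G)"
  shows "smooth_on S f"
proof -
  \<comment> \<open>The product rule extends the hypothesis on generators to the whole algebra,
    which is thus closed under directional derivatives. The induction on \<open>k\<close> below then
    only has to pass to another member of the algebra.\<close>
  have A: "\<exists>D. (\<forall>x\<in>S. (f has_derivative D x) (at x)) \<and> (\<forall>v. (\<lambda>x. D x v) \<in> generated_algebra G)"
    if "f \<in> generated_algebra G" for f
    using that
  proof induction
    case (const a)
    show ?case by (rule exI[of _ "\<lambda>_ _. 0"]) (auto intro: generated_algebra.const)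
  next
    case (gen f)
    then show ?case by (rule G)
  next
    case (add f g)
    then obtain D E where "\<forall>x\<in>S. (f has_derivative D x) (at x)" "\<forall>v. (\<lambda>x. D x v) \<in> generated_algebra G"
      "\<forall>x\<in>S. (g has_derivative E x) (at x)" "\<forall>v. (\<lambda>x. E x v) \<in> generated_algebra G"
      by blast
    then show ?case
      by (intro exI[of _ "\<lambda>x v. D x v + E x v"])
        (auto intro!: derivative_intros generated_algebra_intros)
  next
    case (mult f g)
    then obtain D E where "\<forall>x\<in>S. (f has_derivative D x) (at x)" "\<forall>v. (\<lambda>x. D x v) \<in> generated_algebra G"
      "\<forall>x\<in>S. (g has_derivative E x) (at x)" "\<forall>v. (\<lambda>x. E x v) \<in> generated_algebra G"
      by blast
    with mult.hyps show ?case
      by (intro exI[of _ "\<lambda>x v. f x * E x v + D x v * g x"])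
        (auto intro!: derivative_intros generated_algebra_intros)
  qed
  have "Ck_on k S f" if "f \<in> generated_algebra G" for k f
    using that
  proof (induction k arbitrary: f)
    case 0
    then show ?case
      using A[of f] has_derivative_continuous by (fastforce intro!: continuous_at_imp_continuous_on)
  next
    case (Suc k)
    obtain D where D: "\<forall>x\<in>S. (f has_derivative D x) (at x)" "\<forall>v. (\<lambda>x. D x v) \<in> generated_algebra G"
      using A[OF Suc.prems] by blast
    have "Ck_on k S (\<lambda>x. frechet_derivative f (at x) v)" for v
    proof -
      have "Ck_on k S (\<lambda>x. D x v)"
        using D(2) Suc.IH by blast
      moreover have "frechet_derivative f (at x) v = D x v" if "x \<in> S" for x
        using frechet_derivative_at[of f "D x" x] D(1) that by simp
      ultimately show ?thesis
        using Ck_on_cong[OF \<open>open S\<close>, of "\<lambda>x. frechet_derivative f (at x) v" "\<lambda>x. D x v"] by simp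
    qed
    moreover have "f differentiable (at x)" if "x \<in> S" for x
      using D(1) that differentiableI by blast
    ultimately show ?case by simp
  qed
  with assms(2) show ?thesis by (simp add: smooth_on_def)
qed

lemma grad_eqI:
  assumes "(f has_derivative (\<lambda>h. g \<bullet> h)) (at x)"
  shows "grad f x = g"
  unfolding grad_def frechet_derivative_at[OF assms, symmetric]
  by (rule euclidean_representation)

lemma divergence_eqI:
  assumes "(X has_derivative D) (at x)"
  shows "divergence X x = (\<Sum>b\<in>Basis. D b \<bullet> b)"
  unfolding divergence_def frechet_derivative_at[OF assms, symmetric] ..

lemma sum_Basis_prod:
  fixes f :: "'a::euclidean_space \<times> 'b::euclidean_space \<Rightarrow> 'c::comm_monoid_add"
  shows "sum f Basis = (\<Sum>i\<in>Basis. f (i, 0)) + (\<Sum>i\<in>Basis. f (0, i))"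
proof -
  have "inj_on (\<lambda>u. (u::'a, 0::'b)) Basis" "inj_on (\<lambda>u. (0::'a, u::'b)) Basis"
    by (auto intro!: inj_onI Pair_inject)
  thus ?thesis
    unfolding Basis_prod_def
    by (subst sum.union_disjoint) (auto simp: Basis_prod_def sum.reindex)
qed

section \<open>Initial value problems on the real line\<close>

lemma integral_exp_mult:
  fixes a s :: real
  assumes "a > 0" "s \<ge> 0"
  shows "((\<lambda>u. exp (a * u)) has_integral (exp (a * s) - 1) / a) {0..s}"
proof -
  have "((\<lambda>u. exp (a * u)) has_integral exp (a * s) / a - exp (a * 0) / a) {0..s}"
    using assms
    by (intro fundamental_theorem_of_calculus)
      (auto intro!: derivative_eq_intros simp flip: has_real_derivative_iff_has_vector_derivative)
  then show ?thesis by (simp add: diff_divide_distrib)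
qed

text \<open>The weight \<open>exp (- 2 L s)\<close> makes the Picard map a contraction on the whole half-line.\<close>

lemma picard_half_line:
  fixes G :: "'a::banach \<Rightarrow> 'a"
  assumes lip: "\<And>x y. norm (G x - G y) \<le> L * norm (x - y)" and L: "L > 0"
    and bd: "\<And>x. norm (G x) \<le> B"
  shows "\<exists>X. X 0 = x0 \<and> (\<forall>s\<ge>0. (X has_vector_derivative G (X s)) (at s within {0..}))"
proof -
  have B: "B \<ge> 0" using bd[of undefined] norm_ge_zero order_trans by blast
  have contG: "continuous_on UNIV G"
    using lip L by (intro lipschitz_on_continuous_on[of L] lipschitz_onI) (auto simp: dist_norm)
  \<comment> \<open>The unknown \<open>Y\<close> stands for
    \<open>exp (-2*L*s) *\<^sub>R (X s - x0)\<close>, which turns a solution on the half-line into a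
    fixed point in the complete space of bounded continuous functions.\<close>
  let ?g = "\<lambda>Y u. G (x0 + exp (2*L*u) *\<^sub>R apply_bcontfun Y u)"
  define J where "J Y s = integral {0..s} (?g Y)" for Y s
  \<comment> \<open>Members of that space are defined on the whole line; \<open>max 0 s\<close>
    makes the image of \<open>Y\<close> vanish at negative times.\<close>
  define T where "T Y s = exp (-2*L*max 0 s) *\<^sub>R J Y (max 0 s)" for Y s
  have cont_g: "continuous_on S (?g Y)" for S and Y :: "real \<Rightarrow>\<^sub>C 'a"
    by (intro continuous_intros continuous_on_compose2[OF contG]) auto
  have int_g: "?g Y integrable_on {0..s}" for Y :: "real \<Rightarrow>\<^sub>C 'a" and s
    by (intro integrable_continuous_real cont_g)
  have J_deriv: "(J Y has_vector_derivative ?g Y s) (at s within {0..})" if "s \<ge> 0" for Y s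
  proof -
    have "(J Y has_vector_derivative ?g Y s) (at s within {0..s+1})"
      unfolding J_def using that by (intro integral_has_vector_derivative cont_g) auto
    moreover have "at s within {0..s+1} = at s within {0..}"
      by (rule at_within_nhd[of _ "{..<s+1}"]) auto
    ultimately show ?thesis by simp
  qed
  have J_cont: "continuous_on {0..} (J Y)" for Y
    by (rule continuous_on_vector_derivative[OF J_deriv]) simp
  have T_cont: "continuous_on UNIV (T Y)" for Y
    unfolding T_def
    by (intro continuous_intros continuous_on_compose2[OF J_cont]) auto
  have T_bd: "norm (T Y s) \<le> B / (2*L)" for Y s
  proof -
    let ?t = "max 0 s"
    have "norm (J Y ?t) \<le> B * ?t"
      using has_integral_bound_real[OF B finite.emptyI integrable_integral[OF int_g[of Y ?t]]] bd
      unfolding J_def by auto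
    then have "norm (T Y s) \<le> exp (-2*L*?t) * (B * ?t)"
      unfolding T_def by (simp add: mult_left_mono)
    also have "?t \<le> exp (2*L*?t) / (2*L)"
    proof -
      have "2*L*?t \<le> exp (2*L*?t)"
        using exp_ge_add_one_self[of "2*L*?t"] by linarith
      then show ?thesis using L by (simp only: pos_le_divide_eq mult_pos_pos zero_less_numeral mult.commute[of ?t])
    qed
    then have "exp (-2*L*?t) * (B * ?t) \<le> exp (-2*L*?t) * (B * (exp (2*L*?t) / (2*L)))"
      using B by (intro mult_left_mono) auto
    also have "\<dots> = B / (2*L)" by (simp add: exp_minus field_simps)
    finally show ?thesis .
  qed
  have T_b: "T Y \<in> bcontfun" for Y
    by (rule bcontfun_normI[OF T_cont T_bd])
  \<comment> \<open>Integrating \<open>exp (2*L*u)\<close> gains a factor \<open>1 / (2*L)\<close>,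
    and against the Lipschitz constant \<open>L\<close> this leaves the contraction factor
    1/2.\<close>
  have T_lip: "norm (T Y s - T Z s) \<le> (1/2) * dist Y Z" for Y Z s
  proof -
    let ?t = "max 0 s"
    have "norm (J Y ?t - J Z ?t) = norm (integral {0..?t} (\<lambda>u. ?g Y u - ?g Z u))"
      unfolding J_def by (simp add: integral_diff int_g)
    also have "\<dots> \<le> integral {0..?t} (\<lambda>u. L * dist Y Z * exp (2*L*u))"
    proof (rule integral_norm_bound_integral)
      show "(\<lambda>u. ?g Y u - ?g Z u) integrable_on {0..?t}"
        by (intro integrable_diff int_g)
      show "(\<lambda>u. L * dist Y Z * exp (2*L*u)) integrable_on {0..?t}"
        by (intro integrable_continuous_real continuous_intros)
      fix u
      have "norm (?g Y u - ?g Z u) \<le> L * norm (exp (2*L*u) *\<^sub>R (apply_bcontfun Y u - apply_bcontfun Z u))"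
        using lip[of "x0 + exp (2*L*u) *\<^sub>R apply_bcontfun Y u" "x0 + exp (2*L*u) *\<^sub>R apply_bcontfun Z u"]
        by (simp add: algebra_simps)
      also have "\<dots> \<le> L * (exp (2*L*u) * dist Y Z)"
        using dist_bounded[of Y u Z] L by (simp add: dist_norm)
      finally show "norm (?g Y u - ?g Z u) \<le> L * dist Y Z * exp (2*L*u)" by (simp add: mult_ac)
    qed
    also have "\<dots> = L * dist Y Z * ((exp (2*L*?t) - 1) / (2*L))"
      using integral_exp_mult[of "2*L" ?t] L by (auto dest!: integral_unique)
    also have "\<dots> = dist Y Z * (exp (2*L*?t) - 1) / 2"
      using L by simp
    also have "\<dots> \<le> dist Y Z * exp (2*L*?t) / 2"
      by (simp add: mult_left_mono)
    finally have "exp (-2*L*?t) * norm (J Y ?t - J Z ?t) \<le> exp (-2*L*?t) * (dist Y Z * exp (2*L*?t) / 2)"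
      by (intro mult_left_mono) auto
    also have "\<dots> = (1/2) * dist Y Z" by (simp add: exp_minus field_simps)
    finally show ?thesis
      unfolding T_def by (simp flip: scaleR_diff_right)
  qed
  define F where "F Y = Bcontfun (T Y)" for Y
  have F: "apply_bcontfun (F Y) = T Y" for Y
    unfolding F_def using T_b by (simp add: Bcontfun_inverse)
  have "dist (F Y) (F Z) \<le> (1/2) * dist Y Z" for Y Z
    using T_lip by (intro dist_bound) (simp add: F dist_norm)
  then have "\<exists>!Y. F Y = Y"
    by (intro banach_fix_type[of "1/2"]) auto
  then obtain Y where "F Y = Y" by blast
  then have Y: "apply_bcontfun Y = T Y" using F[of Y] by simp
  define X where "X s = x0 + J Y s" for s
  have "x0 + exp (2 * L * s) *\<^sub>R apply_bcontfun Y s = X s" if "s \<ge> 0" for s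
    using that by (subst Y) (simp add: T_def X_def max_def flip: exp_add)
  then have "(X has_vector_derivative G (X s)) (at s within {0..})" if "s \<ge> 0" for s
    using J_deriv[OF that, of Y] that unfolding X_def by (auto intro!: derivative_eq_intros)
  moreover have "X 0 = x0" by (simp add: X_def J_def)
  ultimately show ?thesis by blast
qed

text \<open>The backward half is a forward solution for \<open>- G\<close>, run in reverse. Both
  halves have the one-sided derivative \<open>G x0\<close> at time 0, so the glued function is
  differentiable there as well.\<close>

lemma picard_real_line:
  fixes G :: "'a::banach \<Rightarrow> 'a"
  assumes lip: "\<And>x y. norm (G x - G y) \<le> L * norm (x - y)" and L: "L > 0"
    and bd: "\<And>x. norm (G x) \<le> B"
  shows "\<exists>X. X 0 = x0 \<and> (\<forall>s. (X has_vector_derivative G (X s)) (at s))"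
proof -
  obtain X where X: "X 0 = x0" "\<And>s. s \<ge> 0 \<Longrightarrow> (X has_vector_derivative G (X s)) (at s within {0..})"
    using picard_half_line[OF assms] by blast
  obtain Y where Y: "Y 0 = x0" "\<And>s. s \<ge> 0 \<Longrightarrow> (Y has_vector_derivative - G (Y s)) (at s within {0..})"
    using picard_half_line[of "\<lambda>x. - G x" L B x0] assms by (auto simp: norm_minus_commute)
  define Z where "Z s = (if s \<in> {0..} then X s else Y (- s))" for s
  have Yneg: "((\<lambda>s. Y (- s)) has_vector_derivative G (Y (- s))) (at s within {..0})" if "s \<le> 0" for s
  proof -
    have "((Y \<circ> uminus) has_vector_derivative (- 1) *\<^sub>R (- G (Y (- s)))) (at s within {..0})"
      using that Y(2)[of "- s"] by (intro vector_diff_chain_within) (auto intro!: derivative_eq_intros)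
    then show ?thesis by (simp add: comp_def)
  qed
  have "(Z has_vector_derivative (if s \<in> {0..} then G (X s) else G (Y (- s)))) (at s within UNIV)" for s
    unfolding Z_def
    by (rule has_vector_derivative_If_within_closures[where T = "{..0}"])
      (use X Y Yneg in \<open>auto simp: Un_absorb2 Un_absorb1\<close>)
  then have "(Z has_vector_derivative G (Z s)) (at s)" for s
    by (smt (verit) Z_def)
  moreover have "Z 0 = x0" by (simp add: Z_def X)
  ultimately show ?thesis by auto
qed

section \<open>Barrier arguments for scalar functions\<close>

text \<open>At the first return to zero the derivative would be negative, so \<open>y\<close> would
  be positive just before, where it is known to be negative. The start \<open>y a = 0\<close> is
  allowed because the angle of the profile curve starts at an end point of its interval; the sign
  condition at \<open>a\<close> then pushes \<open>y\<close> below zero at once.\<close>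

lemma stays_negative:
  fixes y :: "real \<Rightarrow> real"
  assumes deriv: "\<And>s. s \<ge> a \<Longrightarrow> (y has_real_derivative y' s) (at s)"
    and zero: "\<And>s. s \<ge> a \<Longrightarrow> y s = 0 \<Longrightarrow> y' s < 0"
    and start: "y a \<le> 0" and s: "s > a"
  shows "y s < 0"
proof (rule ccontr)
  assume "\<not> y s < 0"
  obtain c where c: "a < c" "c < s" "y c < 0" "\<And>x. a < x \<Longrightarrow> x \<le> c \<Longrightarrow> y x < 0"
  proof -
    have "\<exists>d>0. \<forall>h>0. h < d \<longrightarrow> y (a + h) < 0"
    proof (cases "y a = 0")
      case True
      then show ?thesis using DERIV_neg_dec_right[OF deriv[of a] zero[of a]] by auto
    next
      case False
      then have "y a < 0" using start by simp
      then have "eventually (\<lambda>x. y x < 0) (at a)"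
        using DERIV_isCont[OF deriv[of a]] by (auto simp: isCont_def dest: order_tendstoD)
      then obtain d where "d > 0" "\<forall>x. x \<noteq> a \<and> dist x a < d \<longrightarrow> y x < 0"
        by (auto simp: eventually_at)
      then show ?thesis by (intro exI[of _ d]) (auto simp: dist_real_def)
    qed
    then obtain d where d: "d > 0" "\<And>h. h > 0 \<Longrightarrow> h < d \<Longrightarrow> y (a + h) < 0" by auto
    let ?c = "a + min (d/2) ((s - a)/2)"
    have "y x < 0" if "a < x" "x \<le> ?c" for x
      using d(2)[of "x - a"] d(1) that s by auto
    then show ?thesis using d(1) s by (intro that[of ?c]) (auto simp: min_def field_simps)
  qed
  define K where "K = {x \<in> {c..s}. y x \<in> {0..}}"
  have "continuous_on {c..s} y"
    using c by (intro continuous_at_imp_continuous_on) (auto intro!: DERIV_isCont deriv)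
  then have "closed ({c..s} \<inter> y -` {0..})"
    by (rule continuous_closed_preimage) auto
  then have "compact ({c..s} \<inter> ({c..s} \<inter> y -` {0..}))"
    by (intro compact_Int_closed) auto
  also have "{c..s} \<inter> ({c..s} \<inter> y -` {0..}) = K"
    by (auto simp: K_def)
  finally have "compact K" .
  moreover have "s \<in> K" using \<open>\<not> y s < 0\<close> c by (auto simp: K_def)
  ultimately obtain b where b: "b \<in> K" "\<And>x. x \<in> K \<Longrightarrow> b \<le> x"
    using compact_attains_inf[of K] by blast
  have bc: "c < b" "y b \<ge> 0" using b c by (force simp: K_def order_le_less)+
  have neg: "y x < 0" if "a < x" "x < b" for x
    using that b(2)[of x] b(1) c(4)[of x] by (force simp: K_def)
  have "y b = 0"
  proof (rule antisym)
    have "(y \<longlongrightarrow> y b) (at_left b)"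
      using DERIV_isCont[OF deriv[of b]] bc c by (auto simp: isCont_def intro: tendsto_mono at_le)
    moreover have "eventually (\<lambda>x. x \<in> {a<..<b}) (at_left b)"
      using bc c by (intro eventually_at_left_real) auto
    ultimately show "y b \<le> 0"
      by (intro tendsto_upperbound[of y _ "at_left b"]) (auto elim!: eventually_mono simp: neg less_imp_le)
  qed (use bc in auto)
  then obtain d where d: "d > 0" "\<And>h. h > 0 \<Longrightarrow> h < d \<Longrightarrow> y b < y (b - h)"
    using DERIV_neg_dec_left[OF deriv[of b] zero[of b]] bc c by auto
  let ?h = "min (d/2) ((b - a)/2)"
  have "?h > 0" "?h < d" "a < b - ?h" "b - ?h < b" using d(1) bc c by (auto simp: min_def field_simps)
  with d(2)[of ?h] neg[of "b - ?h"] \<open>y b = 0\<close> show False by simp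
qed

text \<open>While \<open>y\<close> is nonnegative it falls at rate at least \<open>c\<close>, so it
  must become negative; afterwards zero is a barrier. This one principle yields all the trapping
  estimates: \<open>y\<close> is each time the signed distance to a moving barrier.\<close>

lemma eventually_negative:
  fixes y :: "real \<Rightarrow> real"
  assumes deriv: "\<And>s. s \<ge> a \<Longrightarrow> (y has_real_derivative y' s) (at s)"
    and decr: "\<And>s. s \<ge> a \<Longrightarrow> y s \<ge> 0 \<Longrightarrow> y' s \<le> - c" and c: "c > 0"
  shows "\<exists>b\<ge>a. \<forall>s\<ge>b. y s < 0"
proof -
  have "\<exists>b\<ge>a. y b < 0"
  proof (rule ccontr)
    assume "\<not> ?thesis"
    then have pos: "y s \<ge> 0" if "s \<ge> a" for s using that by force
    \<comment> \<open>By this time a descent at rate \<open>c\<close> would have brought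
      \<open>y\<close> down to -1.\<close>
    define b where "b = a + (y a + 1) / c"
    have "a \<le> b" using pos[of a] c by (simp add: b_def)
    have "y b + c * b \<le> y a + c * a"
      using decr pos
      by (intro DERIV_nonpos_imp_nonincreasing[OF \<open>a \<le> b\<close>, of "\<lambda>s. y s + c * s"])
        (force intro!: derivative_eq_intros deriv)
    moreover have "c * b = c * a + y a + 1" using c by (simp add: b_def field_simps)
    ultimately show False using pos[of b] \<open>a \<le> b\<close> by simp
  qed
  then obtain b where b: "b \<ge> a" "y b < 0" by blast
  have "y s < 0" if "s \<ge> b" for s
  proof (cases "s = b")
    case False
    have "y' s < 0" if "s \<ge> b" "y s = 0" for s
      using decr[of s] that b c by simp
    then show ?thesis
      using b False that deriv by (intro stays_negative[of b y y']) auto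
  qed (use b in simp)
  with b show ?thesis by blast
qed

section \<open>The profile curve\<close>

lemma abs_sin_diff_le: "\<bar>sin x - sin y\<bar> \<le> \<bar>x - y :: real\<bar>"
proof -
  have "\<bar>sin x - sin y\<bar> = 2 * \<bar>sin ((x - y) / 2)\<bar> * \<bar>cos ((x + y) / 2)\<bar>"
    by (simp add: sin_diff_sin abs_mult)
  also have "\<dots> \<le> 2 * \<bar>(x - y) / 2\<bar> * 1"
    by (intro mult_mono abs_sin_x_le_abs_x) auto
  finally show ?thesis by simp
qed

lemma abs_cos_diff_le: "\<bar>cos x - cos y\<bar> \<le> \<bar>x - y :: real\<bar>"
  using abs_sin_diff_le[of "pi/2 - x" "pi/2 - y"] by (simp add: sin_diff abs_minus_commute)

text \<open>The profile curve of a rotationally symmetric translator, parametrised by arc length, with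
  \<open>\<theta>\<close> the angle between its tangent and the radial direction. The cut-off \<open>max R r\<close> makes the
  field globally Lipschitz; it is inactive along the solution, where \<open>r \<ge> R\<close>.\<close>

definition profile_field :: "real \<Rightarrow> real \<Rightarrow> real \<times> real \<times> real \<Rightarrow> real \<times> real \<times> real" where
  "profile_field m R = (\<lambda>(r, z, \<theta>). (cos \<theta>, sin \<theta>, cos \<theta> - m * sin \<theta> / max R r))"

lemma profile_field_bound:
  assumes "m > 0" "R > 0"
  shows "norm (profile_field m R p) \<le> 3 + m / R"
proof -
  obtain r z \<theta> where p: "p = (r, z, \<theta>)" by (cases p)
  have "\<bar>cos \<theta> - m * sin \<theta> / max R r\<bar> \<le> \<bar>cos \<theta>\<bar> + m / max R r * \<bar>sin \<theta>\<bar>"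
    using assms by (intro order_trans[OF abs_triangle_ineq4]) (auto simp: abs_mult)
  also have "\<dots> \<le> 1 + m / R * 1"
    using assms by (intro add_mono mult_mono divide_left_mono) auto
  finally have *: "\<bar>cos \<theta> - m * sin \<theta> / max R r\<bar> \<le> 1 + m / R" by simp
  have "norm (profile_field m R p) \<le> \<bar>cos \<theta>\<bar> + (\<bar>sin \<theta>\<bar> + \<bar>cos \<theta> - m * sin \<theta> / max R r\<bar>)"
    unfolding p profile_field_def prod.case
    by (intro order_trans[OF norm_Pair_le] add_mono) (auto simp: norm_Pair_le[THEN order_trans])
  also have "\<dots> \<le> 1 + (1 + (1 + m / R))"
    by (intro add_mono * ) auto
  finally show ?thesis by simp
qed

text \<open>In \<open>m * sin \<theta> / max R r\<close> a change of the angle costs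
  \<open>m / R\<close> and a change of the radius costs \<open>m / R\<^sup>2\<close>, because the
  cut-off bounds the reciprocals. The remaining 3 comes from the bare sines and cosines.\<close>

lemma profile_field_lipschitz:
  assumes "m > 0" "R > 0"
  shows "norm (profile_field m R p - profile_field m R q) \<le> (3 + m / R + m / R\<^sup>2) * norm (p - q)"
proof -
  obtain r z \<theta> where p: "p = (r, z, \<theta>)" by (cases p)
  obtain r' z' \<theta>' where q: "q = (r', z', \<theta>')" by (cases q)
  let ?M = "max R r" and ?M' = "max R r'" and ?N = "norm (p - q)"
  have r: "\<bar>r - r'\<bar> \<le> ?N"
    using norm_fst_le[of "r - r'" "(z - z', \<theta> - \<theta>')"] by (simp add: p q)
  have \<theta>: "\<bar>\<theta> - \<theta>'\<bar> \<le> ?N"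
    using norm_snd_le[of "(z - z', \<theta> - \<theta>')" "r - r'"] norm_snd_le[of "\<theta> - \<theta>'" "z - z'"] by (simp add: p q)
  have M: "?M \<ge> R" "?M' \<ge> R" "\<bar>?M - ?M'\<bar> \<le> \<bar>r - r'\<bar>" by auto
  have s: "\<bar>sin \<theta> - sin \<theta>'\<bar> \<le> ?N" and c: "\<bar>cos \<theta> - cos \<theta>'\<bar> \<le> ?N"
    using abs_sin_diff_le[of \<theta> \<theta>'] abs_cos_diff_le[of \<theta> \<theta>'] \<theta> by linarith+
  have "?M > 0" "?M' > 0" using M assms by auto
  then have "\<bar>1 / ?M - 1 / ?M'\<bar> = \<bar>(?M' - ?M) / (?M * ?M')\<bar>"
    by (auto simp: diff_frac_eq simp del: max_less_iff_conj less_max_iff_disj)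
  also have "\<dots> = \<bar>?M - ?M'\<bar> / (?M * ?M')"
    using \<open>?M > 0\<close> \<open>?M' > 0\<close>
    by (simp only: abs_divide abs_mult abs_of_pos abs_minus_commute)
  also have "\<dots> \<le> ?N / (R * R)"
    using M r assms by (intro frac_le mult_mono) auto
  finally have inv: "\<bar>1 / ?M - 1 / ?M'\<bar> \<le> ?N / (R * R)" .
  have "m * sin \<theta> / ?M - m * sin \<theta>' / ?M' =
      m * (1 / ?M) * (sin \<theta> - sin \<theta>') + m * sin \<theta>' * (1 / ?M - 1 / ?M')"
    by (simp add: algebra_simps diff_divide_distrib)
  also have "\<bar>\<dots>\<bar> \<le> m * (1 / ?M) * \<bar>sin \<theta> - sin \<theta>'\<bar> + m * \<bar>sin \<theta>'\<bar> * \<bar>1 / ?M - 1 / ?M'\<bar>"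
    using assms M by (intro order_trans[OF abs_triangle_ineq]) (auto simp: abs_mult)
  also have "\<dots> \<le> m * (1 / R) * ?N + m * 1 * (?N / (R * R))"
  proof (rule add_mono)
    have "1 / ?M \<le> 1 / R" using assms M by (intro frac_le) auto
    then have "m * (1 / ?M) \<le> m * (1 / R)" using assms by (intro mult_left_mono) auto
    then show "m * (1 / ?M) * \<bar>sin \<theta> - sin \<theta>'\<bar> \<le> m * (1 / R) * ?N"
      using s assms by - (rule mult_mono, auto)
    have "m * \<bar>sin \<theta>'\<bar> \<le> m * 1" using assms by (intro mult_left_mono) auto
    then show "m * \<bar>sin \<theta>'\<bar> * \<bar>1 / ?M - 1 / ?M'\<bar> \<le> m * 1 * (?N / (R * R))"
      using inv assms by - (rule mult_mono, auto)
  qed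
  finally have q3: "\<bar>m * sin \<theta> / ?M - m * sin \<theta>' / ?M'\<bar> \<le> m / R * ?N + m / R\<^sup>2 * ?N"
    by (simp add: power2_eq_square)
  have "norm (profile_field m R p - profile_field m R q) \<le>
      \<bar>cos \<theta> - cos \<theta>'\<bar> + (\<bar>sin \<theta> - sin \<theta>'\<bar>
        + \<bar>(cos \<theta> - m * sin \<theta> / ?M) - (cos \<theta>' - m * sin \<theta>' / ?M')\<bar>)"
    unfolding p q profile_field_def prod.case diff_Pair
    by (intro order_trans[OF norm_Pair_le] add_mono) (auto simp: norm_Pair_le[THEN order_trans])
  also have "\<dots> \<le> ?N + (?N + (?N + (m / R * ?N + m / R\<^sup>2 * ?N)))"
    using s c q3 by (intro add_mono) auto
  finally show ?thesis by (simp add: algebra_simps)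
qed

lemma cos_negative_between:
  fixes x :: real
  assumes "pi / 2 < x" "x < 3 * pi / 2"
  shows "cos x < 0"
proof -
  have "cos (x - pi) > 0" using assms by (intro cos_gt_zero_pi) auto
  then show ?thesis by (simp add: cos_diff)
qed

lemma modified_profile_radius:
  fixes r \<theta> :: "real \<Rightarrow> real"
  assumes m: "m > 0" and R: "R > 0"
    and r': "\<And>s. (r has_real_derivative cos (\<theta> s)) (at s)"
    and \<theta>': "\<And>s. (\<theta> has_real_derivative cos (\<theta> s) - m * sin (\<theta> s) / max R (r s)) (at s)"
    and \<theta>0: "\<theta> 0 = pi / 2 \<or> \<theta> 0 = - pi / 2" and r0: "r 0 = R"
  shows "s > 0 \<Longrightarrow> - pi / 2 < \<theta> s \<and> \<theta> s < pi / 2" "s > 0 \<Longrightarrow> r s > R"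
proof -
  show th: "- pi / 2 < \<theta> s \<and> \<theta> s < pi / 2" if "s > 0" for s
  proof
    have "\<theta> s - pi / 2 < 0"
    proof (rule stays_negative[where a = 0 and y = "\<lambda>s. \<theta> s - pi / 2"])
      show "((\<lambda>s. \<theta> s - pi / 2) has_real_derivative cos (\<theta> s) - m * sin (\<theta> s) / max R (r s)) (at s)" for s
        using \<theta>'[of s] by (auto intro!: derivative_eq_intros)
      show "cos (\<theta> s) - m * sin (\<theta> s) / max R (r s) < 0" if "\<theta> s - pi / 2 = 0" for s
      proof -
        have "\<theta> s = pi / 2" using that by simp
        then have "cos (\<theta> s) = 0" "sin (\<theta> s) = 1" by (simp_all only: cos_pi_half sin_pi_half)
        then show ?thesis using m R by (simp add: less_max_iff_disj)
      qed
    qed (use \<theta>0 that in auto)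
    then show "\<theta> s < pi / 2" by simp
    have "- \<theta> s - pi / 2 < 0"
    proof (rule stays_negative[where a = 0 and y = "\<lambda>s. - \<theta> s - pi / 2"])
      show "((\<lambda>s. - \<theta> s - pi / 2) has_real_derivative - (cos (\<theta> s) - m * sin (\<theta> s) / max R (r s))) (at s)" for s
        using \<theta>'[of s] by (auto intro!: derivative_eq_intros)
      show "- (cos (\<theta> s) - m * sin (\<theta> s) / max R (r s)) < 0" if "- \<theta> s - pi / 2 = 0" for s
      proof -
        have "\<theta> s = - (pi / 2)" using that by simp
        then have "cos (\<theta> s) = 0" "sin (\<theta> s) = - 1" by simp_all
        then show ?thesis using m R by (simp add: less_max_iff_disj)
      qed
    qed (use \<theta>0 that in auto)
    then show "- pi / 2 < \<theta> s" by simp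
  qed
  show "r s > R" if "s > 0"
  proof -
    have "r 0 < r s"
      using that th
      by (intro DERIV_pos_imp_increasing_open[OF that])
        (auto intro!: exI[of _ "cos (\<theta> _)"] r' cos_gt_zero_pi continuous_at_imp_continuous_on DERIV_isCont)
    then show ?thesis by (simp add: r0)
  qed
qed

text \<open>For \<open>s \<le> 0\<close> the curve traversed backwards, with \<open>\<theta>\<close> decreased by \<open>\<pi>\<close>, solves the same
  system, so both wings are instances of a single initial value problem.\<close>

lemma profile_curve_exists:
  assumes m: "m > 0" and R: "R > 0"
  obtains r z \<theta> :: "real \<Rightarrow> real" where
    "r 0 = R" "z 0 = 0" "\<theta> 0 = pi / 2"
    "\<And>s. (r has_real_derivative cos (\<theta> s)) (at s)"
    "\<And>s. (z has_real_derivative sin (\<theta> s)) (at s)"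
    "\<And>s. (\<theta> has_real_derivative cos (\<theta> s) - m * sin (\<theta> s) / r s) (at s)"
    "\<And>s. s > 0 \<Longrightarrow> - pi / 2 < \<theta> s \<and> \<theta> s < pi / 2"
    "\<And>s. s < 0 \<Longrightarrow> pi / 2 < \<theta> s \<and> \<theta> s < 3 * pi / 2"
    "\<And>s. r s \<ge> R"
proof -
  obtain X where X: "X 0 = (R, 0, pi / 2)"
    "\<And>s. (X has_vector_derivative profile_field m R (X s)) (at s)"
    using picard_real_line[where G = "profile_field m R" and L = "3 + m / R + m / R\<^sup>2"
        and B = "3 + m / R" and ?x0.0 = "(R, 0, pi / 2)"]
      profile_field_lipschitz[OF assms] profile_field_bound[OF assms] m R
    by (auto simp: add_pos_pos)
  define r z \<theta> where "r s = fst (X s)" and "z s = fst (snd (X s))" and "\<theta> s = snd (snd (X s))" for s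
  have XX: "X s = (r s, z s, \<theta> s)" for s by (simp add: r_def z_def \<theta>_def)
  have G: "profile_field m R (X s) = (cos (\<theta> s), sin (\<theta> s), cos (\<theta> s) - m * sin (\<theta> s) / max R (r s))" for s
    by (simp add: XX profile_field_def)
  have fst': "((\<lambda>s. fst (Y s)) has_vector_derivative fst d) (at s)"
    and snd': "((\<lambda>s. snd (Y s)) has_vector_derivative snd d) (at s)"
    if "(Y has_vector_derivative d) (at s)" for Y :: "real \<Rightarrow> 'x::real_normed_vector \<times> 'y::real_normed_vector" and d s
    using bounded_linear.has_vector_derivative[OF bounded_linear_fst that]
      bounded_linear.has_vector_derivative[OF bounded_linear_snd that] by auto
  have r': "(r has_real_derivative cos (\<theta> s)) (at s)" for s
    using fst'[OF X(2)[of s]] unfolding r_def[symmetric] G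
    by (simp add: has_real_derivative_iff_has_vector_derivative)
  have z': "(z has_real_derivative sin (\<theta> s)) (at s)" for s
    using fst'[OF snd'[OF X(2)[of s]]] unfolding z_def[symmetric] G
    by (simp add: has_real_derivative_iff_has_vector_derivative)
  have \<theta>': "(\<theta> has_real_derivative cos (\<theta> s) - m * sin (\<theta> s) / max R (r s)) (at s)" for s
    using snd'[OF snd'[OF X(2)[of s]]] unfolding \<theta>_def[symmetric] G
    by (simp add: has_real_derivative_iff_has_vector_derivative)
  have init: "r 0 = R" "z 0 = 0" "\<theta> 0 = pi / 2"
    using X(1) by (auto simp: r_def z_def \<theta>_def)
  note fwd = modified_profile_radius[OF m R r' \<theta>']
  have mir: "((\<lambda>s. r (- s)) has_real_derivative cos (\<theta> (- s) - pi)) (at s)"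
    "((\<lambda>s. \<theta> (- s) - pi) has_real_derivative
      cos (\<theta> (- s) - pi) - m * sin (\<theta> (- s) - pi) / max R (r (- s))) (at s)" for s
    using DERIV_chain2[OF r'[of "- s"] DERIV_minus[OF DERIV_ident]]
      DERIV_diff[OF DERIV_chain2[OF \<theta>'[of "- s"] DERIV_minus[OF DERIV_ident]] DERIV_const[of pi]]
    by (auto simp: cos_diff sin_diff)
  note bwd = modified_profile_radius[OF m R mir]
  have neg: "pi / 2 < \<theta> s \<and> \<theta> s < 3 * pi / 2" "r s > R" if "s < 0" for s
    using bwd[of "- s"] that init by auto
  have rR: "r s \<ge> R" for s
    using fwd(2)[of s] neg(2)[of s] init by (cases s "0::real" rule: linorder_cases) auto
  show thesis
  proof (rule that[OF init r' z'])
    show "(\<theta> has_real_derivative cos (\<theta> s) - m * sin (\<theta> s) / r s) (at s)" for s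
      using \<theta>'[of s] rR[of s] by (simp add: max_absorb2)
  qed (use fwd(1) init neg rR in auto)
qed

section \<open>Asymptotics of the slope and the height\<close>

text \<open>The derivative bound makes \<open>g r - K / r\<close> nondecreasing and
  \<open>g r + K / r\<close> nonincreasing. The intervals between them are nested, and
  \<open>C\<close> is a common point.\<close>

lemma rate_of_convergence:
  fixes g g' :: "real \<Rightarrow> real"
  assumes b: "b > 0"
    and g': "\<And>r. r \<ge> b \<Longrightarrow> (g has_real_derivative g' r) (at r)"
    and bd: "\<And>r. r \<ge> b \<Longrightarrow> \<bar>g' r\<bar> \<le> K / r\<^sup>2"
  shows "\<exists>C. \<forall>r\<ge>b. \<bar>g r - C\<bar> \<le> K / r"
proof -
  have up: "g s - K / s \<le> g t - K / t" if "b \<le> s" "s \<le> t" for s t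
  proof (rule DERIV_nonneg_imp_nondecreasing[OF \<open>s \<le> t\<close>])
    fix x assume x: "s \<le> x" "x \<le> t"
    then have "((\<lambda>r. g r - K / r) has_real_derivative g' x + K / x\<^sup>2) (at x)"
      using that b by (auto intro!: derivative_eq_intros g' simp: power2_eq_square)
    moreover have "g' x + K / x\<^sup>2 \<ge> 0" using bd[of x] that x by (auto simp: abs_le_iff)
    ultimately show "\<exists>y. ((\<lambda>r. g r - K / r) has_real_derivative y) (at x) \<and> y \<ge> 0" by blast
  qed
  have down: "g t + K / t \<le> g s + K / s" if "b \<le> s" "s \<le> t" for s t
  proof (rule DERIV_nonpos_imp_nonincreasing[OF \<open>s \<le> t\<close>])
    fix x assume x: "s \<le> x" "x \<le> t"
    then have "((\<lambda>r. g r + K / r) has_real_derivative g' x - K / x\<^sup>2) (at x)"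
      using that b by (auto intro!: derivative_eq_intros g' simp: power2_eq_square)
    moreover have "g' x - K / x\<^sup>2 \<le> 0" using bd[of x] that x by (auto simp: abs_le_iff)
    ultimately show "\<exists>y. ((\<lambda>r. g r + K / r) has_real_derivative y) (at x) \<and> y \<le> 0" by blast
  qed
  have K: "K / t \<ge> 0" if "t \<ge> b" for t
    using bd[of t] that b
    by (metis abs_ge_zero order_trans zero_le_divide_iff zero_le_power2 less_le_trans linorder_not_less
        power2_less_0 zero_less_power order_less_imp_le)
  have le: "g s - K / s \<le> g t + K / t" if "s \<ge> b" "t \<ge> b" for s t
  proof -
    have "b \<le> max s t" using that by simp
    then show ?thesis
      using up[of s "max s t"] down[of t "max s t"] K[of "max s t"] that by linarith
  qed
  define C where "C = (SUP s\<in>{b..}. g s - K / s)"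
  have "bdd_above ((\<lambda>s. g s - K / s) ` {b..})"
    using le[of _ b] by (auto intro!: bdd_aboveI2)
  then have "g r - K / r \<le> C" if "r \<ge> b" for r
    unfolding C_def using that by (intro cSUP_upper) auto
  moreover have "C \<le> g r + K / r" if "r \<ge> b" for r
    unfolding C_def using that le by (intro cSUP_least) auto
  ultimately show ?thesis by (intro exI[of _ C]) (auto simp: abs_le_iff algebra_simps)
qed

text \<open>The quantity \<open>e = r\<^sup>2 / m - r \<phi>\<close> satisfies
  \<open>e' = (r / m) (1 - e) + O(1)\<close> once \<open>e\<close> is bounded, so \<open>e = 1 + O(1 / r)\<close>; this is
  \<open>\<phi> = r / m - 1 / r + O(r\<^sup>-\<^sup>2)\<close>.\<close>

lemma translator_slope_asymptotics:
  fixes \<phi> :: "real \<Rightarrow> real"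
  assumes m: "m \<ge> 1" and R: "R > 0"
    and \<phi>': "\<And>r. r > R \<Longrightarrow> (\<phi> has_real_derivative (1 + (\<phi> r)\<^sup>2) * (1 - m * \<phi> r / r)) (at r)"
  shows "\<exists>K b. b > R \<and> (\<forall>r\<ge>b. \<bar>\<phi> r - (r / m - 1 / r)\<bar> \<le> K / r\<^sup>2)"
proof -
  \<comment> \<open>Above the line \<open>r / m\<close> the slope does not increase, whereas the
    line rises at rate \<open>1 / m\<close>. Starting at \<open>R + 1\<close> ensures
    \<open>r \<ge> 1\<close> in the estimates further on.\<close>
  have "\<exists>b\<ge>R+1. \<forall>r\<ge>b. \<phi> r - r / m < 0"
  proof (rule eventually_negative[where c = "1 / m"])
    fix r assume r: "r \<ge> R + 1"
    show "((\<lambda>r. \<phi> r - r / m) has_real_derivative (1 + (\<phi> r)\<^sup>2) * (1 - m * \<phi> r / r) - 1 / m) (at r)"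
      using r m by (auto intro!: derivative_eq_intros \<phi>')
    assume "\<phi> r - r / m \<ge> 0"
    then have "1 - m * \<phi> r / r \<le> 0" using r R m by (simp add: field_simps)
    then show "(1 + (\<phi> r)\<^sup>2) * (1 - m * \<phi> r / r) - 1 / m \<le> - (1 / m)"
      by (simp add: mult_nonneg_nonpos)
  qed (use m in auto)
  then obtain b1 where b1: "b1 \<ge> R + 1" "\<And>r. r \<ge> b1 \<Longrightarrow> \<phi> r < r / m" by auto
  \<comment> \<open>Below \<open>r / (4 * m)\<close> the slope rises at rate at least 3/4 and the
    barrier at rate at most 1/4, so the gap closes at rate 1/2.\<close>
  have "\<exists>b\<ge>b1. \<forall>r\<ge>b. r / (4 * m) - \<phi> r < 0"
  proof (rule eventually_negative[where c = "1 / 2"])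
    fix r assume r: "r \<ge> b1"
    then have r0: "r > 0" using b1 R by simp
    show "((\<lambda>r. r / (4 * m) - \<phi> r) has_real_derivative 1 / (4 * m) - (1 + (\<phi> r)\<^sup>2) * (1 - m * \<phi> r / r)) (at r)"
      using r b1 m by (auto intro!: derivative_eq_intros \<phi>')
    assume "r / (4 * m) - \<phi> r \<ge> 0"
    then have "1 - m * \<phi> r / r \<ge> 3 / 4" using r0 m by (simp add: field_simps)
    then have "1 * (3 / 4) \<le> (1 + (\<phi> r)\<^sup>2) * (1 - m * \<phi> r / r)"
      by (intro mult_mono) auto
    moreover have "1 / (4 * m) \<le> 1 / 4" using m by (simp add: field_simps)
    ultimately show "1 / (4 * m) - (1 + (\<phi> r)\<^sup>2) * (1 - m * \<phi> r / r) \<le> - (1 / 2)" by simp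
  qed auto
  then obtain b2 where b2: "b2 \<ge> b1" "\<And>r. r \<ge> b2 \<Longrightarrow> \<phi> r > r / (4 * m)" by auto
  define e where "e r = r\<^sup>2 / m - r * \<phi> r" for r
  define e' where "e' r = 2 * r / m - \<phi> r - r * ((1 + (\<phi> r)\<^sup>2) * (1 - m * \<phi> r / r))" for r
  have e': "(e has_real_derivative e' r) (at r)" if "r \<ge> b2" for r
    unfolding e_def[abs_def] e'_def using that b1 b2 m R
    by (auto intro!: derivative_eq_intros \<phi>')
  have e_pos: "e r > 0" if "r \<ge> b2" for r
    using that b1(2)[of r] b2(1) b1(1) R m by (simp add: e_def power2_eq_square field_simps)
  have one_minus: "1 - m * \<phi> r / r = m * e r / r\<^sup>2" if "r \<ge> b2" for r
    using that b2(1) b1(1) R m by (simp add: e_def power2_eq_square field_simps)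
  \<comment> \<open>The constant is 3 * 16. The lower barrier gives
    \<open>(\<phi> r)\<^sup>2 \<ge> r\<^sup>2 / (16 * m\<^sup>2)\<close>, so
    \<open>e r \<ge> 48\<close> makes the subtracted product in \<open>e'\<close> at least
    \<open>3 * r / m\<close>, which outweighs \<open>2 * r / m\<close>.\<close>
  have "\<exists>b\<ge>b2. \<forall>r\<ge>b. e r - 48 < 0"
  proof (rule eventually_negative[where c = "b2 / m" and y' = e'])
    fix r assume r: "r \<ge> b2"
    then have r0: "r > 0" using b1 b2 R by simp
    show "((\<lambda>r. e r - 48) has_real_derivative e' r) (at r)"
      using e'[OF r] by (auto intro!: derivative_eq_intros)
    assume e48: "e r - 48 \<ge> 0"
    have "(r / (4 * m))\<^sup>2 \<le> (\<phi> r)\<^sup>2"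
      using b2(2)[OF r] r0 m by (intro power_mono) auto
    then have "(r / (4 * m))\<^sup>2 * (m * 48 / r\<^sup>2) \<le> (1 + (\<phi> r)\<^sup>2) * (m * e r / r\<^sup>2)"
      using e48 m by (intro mult_mono divide_right_mono mult_left_mono) auto
    moreover have "(r / (4 * m))\<^sup>2 * (m * 48 / r\<^sup>2) = 3 / m"
      using r0 m by (simp add: power2_eq_square field_simps)
    ultimately have "3 / m \<le> (1 + (\<phi> r)\<^sup>2) * (1 - m * \<phi> r / r)"
      using one_minus[OF r] by simp
    then have "r * (3 / m) \<le> r * ((1 + (\<phi> r)\<^sup>2) * (1 - m * \<phi> r / r))"
      using r0 by (intro mult_left_mono) auto
    moreover have "\<phi> r \<ge> 0" using b2(2)[OF r] r0 m by (smt (verit) divide_nonneg_nonneg)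
    ultimately have "e' r \<le> - (r / m)" by (simp add: e'_def)
    also have "\<dots> \<le> - (b2 / m)" using r m by (simp add: divide_right_mono)
    finally show "e' r \<le> - (b2 / m)" .
  qed (use b1 b2 m R in auto)
  then obtain b3 where b3: "b3 \<ge> b2" "\<And>r. r \<ge> b3 \<Longrightarrow> e r < 48" by auto
  \<comment> \<open>This is the exact remainder once the relaxation of \<open>e\<close> towards 1 is
    split off; it is bounded because \<open>0 < e r < 48\<close> and
    \<open>r \<ge> 1\<close>.\<close>
  define B where "B r = e r / r * (1 - m + 2 * e r - m * (e r)\<^sup>2 / r\<^sup>2)" for r
  have e'_eq: "e' r = r / m * (1 - e r) + B r" if "r \<ge> b2" for r
  proof -
    have r: "r > 0" using that b1 b2 R by simp
    have \<phi>: "\<phi> r = r / m - e r / r"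
      using r m by (simp add: e_def power2_eq_square field_simps)
    have "e' r = 2 * r / m - \<phi> r - r * ((1 + (\<phi> r)\<^sup>2) * (m * e r / r\<^sup>2))"
      unfolding e'_def one_minus[OF that] ..
    also have "\<dots> = r / m * (1 - e r) + B r"
      unfolding \<phi> B_def using r m by (simp add: field_simps) algebra
    finally show ?thesis .
  qed
  define M where "M = 48 * (1 + m + 2 * 48 + m * 48\<^sup>2)"
  have M: "\<bar>B r\<bar> \<le> M" if "r \<ge> b3" for r
  proof -
    have r: "r \<ge> 1" "0 \<le> e r" "e r \<le> 48"
      using that b1 b2 b3 R e_pos[of r] by (auto simp: less_imp_le)
    have "e r / r \<le> 48 / 1" using r by (intro frac_le) auto
    moreover have "(e r)\<^sup>2 / r\<^sup>2 \<le> 48\<^sup>2 / 1" using r by (intro frac_le power_mono) auto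
    then have "m * ((e r)\<^sup>2 / r\<^sup>2) \<le> m * 48\<^sup>2" using m by (intro mult_left_mono) auto
    then have "\<bar>1 - m + 2 * e r - m * (e r)\<^sup>2 / r\<^sup>2\<bar> \<le> 1 + m + 2 * 48 + m * 48\<^sup>2"
      using r m by (smt (verit, best) divide_nonneg_nonneg mult_nonneg_nonneg zero_le_power2 times_divide_eq_right)
    ultimately have "\<bar>e r / r\<bar> * \<bar>1 - m + 2 * e r - m * (e r)\<^sup>2 / r\<^sup>2\<bar> \<le> M"
      unfolding M_def using r by (intro mult_mono) auto
    then show ?thesis by (simp add: B_def abs_mult)
  qed
  have M0: "M \<ge> 0" using M[of b3] by simp
  \<comment> \<open>At or beyond the barriers \<open>1 + K / r\<close> and \<open>1 - K / r\<close>
    the relaxation pulls back at rate at least \<open>K / m = 2 * (M + 1)\<close>. The remainder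
    costs at most \<open>M\<close> and the motion of the barrier at most \<open>M + 1\<close>, which
    leaves rate 1.\<close>
  define K where "K = 2 * m * (M + 1)"
  have K0: "K > 0" using M0 m by (simp add: K_def)
  define b4 where "b4 = max b3 (2 * m)"
  have b4: "b4 \<ge> b3" "b4 \<ge> 2 * m" "b4 \<ge> 1" "b4 > 0" using m by (auto simp: b4_def)
  have small: "K / r\<^sup>2 \<le> M + 1" and Km: "K / m = 2 * (M + 1)" if "r \<ge> b4" for r
  proof -
    have "2 * m * 1 \<le> r * r" using that b4 m by (intro mult_mono) auto
    then have "K / r\<^sup>2 \<le> K / (2 * m)"
      using K0 m that b4 by (intro divide_left_mono) (auto simp: power2_eq_square)
    then show "K / r\<^sup>2 \<le> M + 1" using m by (simp add: K_def)
    show "K / m = 2 * (M + 1)" using m by (simp add: K_def)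
  qed
  have dK: "((\<lambda>r. K / r) has_real_derivative - (K / r\<^sup>2)) (at r)" if "r \<ge> b4" for r
    using that b4 by (auto intro!: derivative_eq_intros simp: power2_eq_square)
  have "\<exists>b\<ge>b4. \<forall>r\<ge>b. e r - 1 - K / r < 0"
  proof (rule eventually_negative[where c = 1 and y' = "\<lambda>r. e' r - 0 - - (K / r\<^sup>2)"])
    fix r assume r: "r \<ge> b4"
    show "((\<lambda>r. e r - 1 - K / r) has_real_derivative e' r - 0 - - (K / r\<^sup>2)) (at r)"
      using r b4 b3 by (intro DERIV_diff e' DERIV_const dK) auto
    assume "e r - 1 - K / r \<ge> 0"
    then have "r / m * (1 - e r) \<le> r / m * (- (K / r))"
      using r b4 m by (intro mult_left_mono) auto
    also have "\<dots> = - (K / m)" using r b4 m by simp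
    finally show "e' r - 0 - - (K / r\<^sup>2) \<le> - 1"
      using e'_eq[of r] M[of r] small[OF r] Km[OF r] r b4 b3 by simp
  qed auto
  then obtain b5 where b5: "b5 \<ge> b4" "\<And>r. r \<ge> b5 \<Longrightarrow> e r - 1 - K / r < 0" by auto
  have "\<exists>b\<ge>b5. \<forall>r\<ge>b. 1 - K / r - e r < 0"
  proof (rule eventually_negative[where c = 1 and y' = "\<lambda>r. 0 - - (K / r\<^sup>2) - e' r"])
    fix r assume r5: "r \<ge> b5"
    then have r: "r \<ge> b4" using b5 by simp
    show "((\<lambda>r. 1 - K / r - e r) has_real_derivative 0 - - (K / r\<^sup>2) - e' r) (at r)"
      using r b4 b3 by (intro DERIV_diff e' DERIV_const dK) auto
    assume "1 - K / r - e r \<ge> 0"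
    then have "r / m * (K / r) \<le> r / m * (1 - e r)"
      using r b4 m by (intro mult_left_mono) auto
    moreover have "r / m * (K / r) = K / m" using r b4 m by simp
    ultimately show "0 - - (K / r\<^sup>2) - e' r \<le> - 1"
      using e'_eq[of r] M[of r] small[OF r] Km[OF r] r b4 b3 by simp
  qed auto
  then obtain b6 where b6: "b6 \<ge> b5" "\<And>r. r \<ge> b6 \<Longrightarrow> 1 - K / r - e r < 0" by auto
  show ?thesis
  proof (intro exI conjI allI impI)
    show "b6 > R" using b1 b2 b3 b4 b5 b6 by linarith
    fix r assume r: "r \<ge> b6"
    then have r0: "r > 0" using b4 b5 b6 by linarith
    have "\<phi> r - (r / m - 1 / r) = (1 - e r) / r"
      using r0 m by (simp add: e_def power2_eq_square field_simps)
    also have "\<bar>\<dots>\<bar> = \<bar>1 - e r\<bar> / r" using r0 by (simp add: abs_divide)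
    also have "\<bar>1 - e r\<bar> \<le> K / r"
      using b5(2)[of r] b6(2)[of r] b6(1) r by (simp add: abs_le_iff)
    then have "\<bar>1 - e r\<bar> / r \<le> K / r / r" using r0 by (intro divide_right_mono) auto
    finally show "\<bar>\<phi> r - (r / m - 1 / r)\<bar> \<le> K / r\<^sup>2" by (simp add: power2_eq_square)
  qed
qed

text \<open>The slope differs from \<open>r / m - 1 / r\<close> by an error of order
  \<open>1 / r\<^sup>2\<close>, which is integrable at infinity. Its integral produces the constant
  \<open>C\<close> and a tail of order \<open>1 / r\<close>.\<close>

lemma translator_height_asymptotics:
  fixes w \<phi> :: "real \<Rightarrow> real"
  assumes m: "m \<ge> 1" and R: "R > 0"
    and w': "\<And>r. r > R \<Longrightarrow> (w has_real_derivative \<phi> r) (at r)"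
    and \<phi>': "\<And>r. r > R \<Longrightarrow> (\<phi> has_real_derivative (1 + (\<phi> r)\<^sup>2) * (1 - m * \<phi> r / r)) (at r)"
  shows "\<exists>C K b. b > R \<and> (\<forall>r\<ge>b. \<bar>w r - (r\<^sup>2 / (2 * m) - ln r + C)\<bar> \<le> K / r)"
proof -
  obtain K b where b: "b > R" "\<And>r. r \<ge> b \<Longrightarrow> \<bar>\<phi> r - (r / m - 1 / r)\<bar> \<le> K / r\<^sup>2"
    using translator_slope_asymptotics[OF m R \<phi>'] by blast
  have "\<exists>C. \<forall>r\<ge>b. \<bar>(w r - (r\<^sup>2 / (2 * m) - ln r)) - C\<bar> \<le> K / r"
  proof (rule rate_of_convergence)
    fix r assume r: "r \<ge> b"
    show "((\<lambda>r. w r - (r\<^sup>2 / (2 * m) - ln r)) has_real_derivative \<phi> r - (r / m - 1 / r)) (at r)"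
      using r b R m by (auto intro!: derivative_eq_intros w' simp: field_simps)
    show "\<bar>\<phi> r - (r / m - 1 / r)\<bar> \<le> K / r\<^sup>2" using b(2)[OF r] .
  qed (use b R in simp)
  then show ?thesis using b by (auto simp: diff_diff_eq algebra_simps)
qed

section \<open>The wings as graphs\<close>

text \<open>If the radius stayed below \<open>B\<close>, the term
  \<open>m * sin \<theta> / r\<close> would dominate at steep angles and drive
  \<open>\<theta>\<close> into a fixed interval from \<open>- \<beta>\<close> to
  \<open>\<beta>\<close> with \<open>\<beta> < pi / 2\<close>. There the radius grows at rate at
  least \<open>cos \<beta>\<close>, a contradiction.\<close>

lemma wing_radius_unbounded:
  fixes r \<theta> :: "real \<Rightarrow> real"
  assumes m: "m > 0" and R: "R > 0"
    and r': "\<And>s. (r has_real_derivative cos (\<theta> s)) (at s)"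
    and \<theta>': "\<And>s. (\<theta> has_real_derivative cos (\<theta> s) - m * sin (\<theta> s) / r s) (at s)"
    and \<theta>: "\<And>s. s > 0 \<Longrightarrow> - pi / 2 < \<theta> s \<and> \<theta> s < pi / 2"
    and rR: "\<And>s. r s \<ge> R"
  shows "\<exists>s\<ge>0. r s \<ge> B"
proof (rule ccontr)
  assume "\<not> ?thesis"
  then have B: "r s < B" if "s \<ge> 0" for s using that by force
  have B0: "B > 0" using B[of 0] rR[of 0] R by simp
  \<comment> \<open>Chosen so that \<open>m * sin \<beta> / B = 2 * cos \<beta>\<close>: for angles
    from \<open>\<beta>\<close> up to \<open>pi / 2\<close> the derivative of
    \<open>\<theta>\<close> is then at most \<open>- cos \<beta>\<close>.\<close>
  define \<beta> where "\<beta> = arctan (2 * B / m)"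
  have \<beta>: "0 < \<beta>" "\<beta> < pi / 2"
    using B0 m arctan_ubound[of "2 * B / m"] unfolding \<beta>_def by simp_all
  have c: "cos \<beta> > 0" using \<beta> by (intro cos_gt_zero_pi) auto
  have sn: "sin \<beta> > 0" using \<beta> by (intro sin_gt_zero) auto
  have "tan \<beta> = 2 * B / m" by (simp add: \<beta>_def tan_arctan)
  then have sin_\<beta>: "m * sin \<beta> = 2 * B * cos \<beta>"
    using c m by (simp add: tan_def field_simps)
  have key: "cos x - m * sin x / r s \<le> - cos \<beta>" if "s \<ge> 0" "\<beta> \<le> x" "x < pi / 2" for s x
  proof -
    have "cos x \<le> cos \<beta>" using that \<beta> by (intro cos_monotone_0_pi_le) auto
    moreover have "sin \<beta> \<le> sin x" using that \<beta> by (intro sin_monotone_2pi_le) auto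
    then have "m * sin \<beta> / B \<le> m * sin x / r s"
      using m B[OF that(1)] rR[of s] R sn by (intro frac_le mult_left_mono mult_nonneg_nonneg) auto
    moreover have "m * sin \<beta> / B = 2 * cos \<beta>" using sin_\<beta> B0 by simp
    ultimately show ?thesis by simp
  qed
  have "\<exists>b\<ge>1. \<forall>s\<ge>b. \<theta> s - \<beta> < 0"
  proof (rule eventually_negative[where c = "cos \<beta>"])
    fix s :: real assume s: "s \<ge> 1"
    show "((\<lambda>s. \<theta> s - \<beta>) has_real_derivative cos (\<theta> s) - m * sin (\<theta> s) / r s) (at s)"
      by (auto intro!: derivative_eq_intros \<theta>')
    assume "\<theta> s - \<beta> \<ge> 0"
    then show "cos (\<theta> s) - m * sin (\<theta> s) / r s \<le> - cos \<beta>"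
      using s \<theta>[of s] by (intro key) auto
  qed (rule c)
  then obtain b1 where b1: "b1 \<ge> 1" "\<And>s. s \<ge> b1 \<Longrightarrow> \<theta> s < \<beta>" by auto
  have "\<exists>b\<ge>b1. \<forall>s\<ge>b. - \<theta> s - \<beta> < 0"
  proof (rule eventually_negative[where c = "cos \<beta>"])
    fix s :: real assume s: "s \<ge> b1"
    show "((\<lambda>s. - \<theta> s - \<beta>) has_real_derivative - (cos (\<theta> s) - m * sin (\<theta> s) / r s)) (at s)"
      by (auto intro!: derivative_eq_intros \<theta>')
    assume "- \<theta> s - \<beta> \<ge> 0"
    then have "\<theta> s \<le> - \<beta>" by simp
    \<comment> \<open>For negative angles the cosine and the sine term both push
      \<open>\<theta>\<close> upwards, so the estimate \<open>key\<close> at the reflected angle is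
      more than enough.\<close>
    then show "- (cos (\<theta> s) - m * sin (\<theta> s) / r s) \<le> - cos \<beta>"
      using b1(2)[OF s] b1(1) s \<theta>[of s] key[of s "- \<theta> s"] \<beta> c
        cos_gt_zero_pi[of "\<theta> s"]
      by simp
  qed (rule c)
  then obtain b2 where b2: "b2 \<ge> b1" "\<And>s. s \<ge> b2 \<Longrightarrow> - \<theta> s < \<beta>" by auto
  have "\<exists>b\<ge>b2. \<forall>s\<ge>b. B - r s < 0"
  proof (rule eventually_negative[where c = "cos \<beta>"])
    fix s :: real assume s: "s \<ge> b2"
    show "((\<lambda>s. B - r s) has_real_derivative - cos (\<theta> s)) (at s)"
      by (auto intro!: derivative_eq_intros r')
    have "cos \<beta> \<le> cos \<bar>\<theta> s\<bar>"
      using b1(2)[of s] b2(1) b2(2)[of s] s \<beta> by (intro cos_monotone_0_pi_le) auto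
    then show "- cos (\<theta> s) \<le> - cos \<beta>" by simp
  qed (rule c)
  then obtain b where "b \<ge> b2" "B - r b < 0" by auto
  with B[of b] b1 b2 show False by simp
qed

text \<open>For positive \<open>s\<close> the radius is strictly increasing, by the positive cosine,
  and it is unbounded, so it can replace arc length as the parameter; \<open>\<phi>\<close> is the
  tangent of the angle. The angle at \<open>s = 0\<close> decides in which direction the slope blows
  up at \<open>R\<close>.\<close>

lemma wing_exists:
  fixes r z \<theta> :: "real \<Rightarrow> real"
  assumes m: "m > 0" and R: "R > 0"
    and r': "\<And>s. (r has_real_derivative cos (\<theta> s)) (at s)"
    and z': "\<And>s. (z has_real_derivative sin (\<theta> s)) (at s)"
    and \<theta>': "\<And>s. (\<theta> has_real_derivative cos (\<theta> s) - m * sin (\<theta> s) / r s) (at s)"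
    and \<theta>: "\<And>s. s > 0 \<Longrightarrow> - pi / 2 < \<theta> s \<and> \<theta> s < pi / 2"
    and rR: "\<And>s. r s \<ge> R" and r0: "r 0 = R"
  obtains w \<phi> :: "real \<Rightarrow> real" where
    "\<And>s. s \<ge> 0 \<Longrightarrow> w (r s) = z s"
    "\<And>\<rho>. \<rho> \<ge> R \<Longrightarrow> \<exists>s\<ge>0. r s = \<rho>"
    "continuous_on {R..} w"
    "\<And>\<rho>. \<rho> > R \<Longrightarrow> (w has_real_derivative \<phi> \<rho>) (at \<rho>)"
    "\<And>\<rho>. \<rho> > R \<Longrightarrow> (\<phi> has_real_derivative (1 + (\<phi> \<rho>)\<^sup>2) * (1 - m * \<phi> \<rho> / \<rho>)) (at \<rho>)"
    "\<theta> 0 = pi / 2 \<Longrightarrow> filterlim \<phi> at_top (at_right R)"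
    "\<theta> 0 = - pi / 2 \<Longrightarrow> filterlim \<phi> at_bot (at_right R)"
proof -
  have cos_pos: "cos (\<theta> s) > 0" if "s > 0" for s
    using \<theta>[OF that] by (intro cos_gt_zero_pi) auto
  have r_cont: "continuous_on A r" for A
    by (auto intro!: continuous_at_imp_continuous_on DERIV_isCont r')
  have z_cont: "continuous_on A z" for A
    by (auto intro!: continuous_at_imp_continuous_on DERIV_isCont z')
  have mono: "r s < r t" if "0 \<le> s" "s < t" for s t
    using that cos_pos
    by (intro DERIV_pos_imp_increasing_open[OF \<open>s < t\<close>]) (auto intro!: exI[of _ "cos (\<theta> _)"] r' r_cont)
  have inj: "inj_on r {0..}"
    using mono by (auto intro!: linorder_inj_onI' simp: less_le) 
  have surj: "\<exists>s\<ge>0. r s = \<rho>" if "\<rho> \<ge> R" for \<rho>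
  proof -
    obtain t where "t \<ge> 0" "r t \<ge> \<rho>"
      using wing_radius_unbounded[OF m R r' \<theta>' \<theta> rR] by blast
    then show ?thesis
      using IVT'[of r 0 \<rho> t] that r0 r_cont by auto
  qed
  \<comment> \<open>Continuing the inverse of \<open>r\<close> by a line of slope 1 below
    \<open>R\<close> gives a monotone surjection of the whole line, which is automatically
    continuous. In particular \<open>S\<close> is continuous at \<open>R\<close> itself, where the
    derivative of \<open>r\<close> vanishes and the inverse function rule fails.\<close>
  define S where "S \<rho> = (if \<rho> < R then \<rho> - R else inv_into {0..} r \<rho>)" for \<rho>
  have S_r: "S (r s) = s" if "s \<ge> 0" for s
    using that rR[of s] inj by (simp add: S_def)
  have r_S: "r (S \<rho>) = \<rho>" and S_nonneg: "S \<rho> \<ge> 0" if "\<rho> \<ge> R" for \<rho>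
    using surj[OF that] S_r by auto
  have S_mono: "S x \<le> S y" if "x \<le> y" for x y
  proof (cases "x < R")
    case True
    then show ?thesis using that S_nonneg[of y] by (cases "y < R") (auto simp: S_def)
  next
    case False
    then show ?thesis
      using mono[of "S y" "S x"] S_nonneg[of y] r_S[of x] r_S[of y] that by (force simp: not_le[symmetric])
  qed
  have "s \<in> range S" for s
  proof (cases "s \<ge> 0")
    case True
    then show ?thesis using S_r by (metis rangeI)
  next
    case False
    then have "S (s + R) = s" by (simp add: S_def)
    then show ?thesis by (metis rangeI)
  qed
  then have "range S = UNIV" by blast
  then have "continuous_on UNIV S"
    using S_mono by (intro continuous_onI_mono) auto
  then have S_cont: "isCont S \<rho>" for \<rho>
    by (simp add: continuous_on_eq_continuous_at)
  have S0: "S R = 0" using S_r[of 0] r0 by simp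
  have S_pos: "S \<rho> > 0" if "\<rho> > R" for \<rho>
    using S_nonneg[of \<rho>] r_S[of \<rho>] r0 that by (cases "S \<rho> = 0") auto
  have S': "(S has_real_derivative inverse (cos (\<theta> (S \<rho>)))) (at \<rho>)" if "\<rho> > R" for \<rho>
    using that cos_pos[OF S_pos[OF that]] r_S S_cont
    by (intro DERIV_inverse_function[where f = r and a = R and b = "\<rho> + 1"] r') auto
  define w where "w \<rho> = z (S \<rho>)" for \<rho>
  define \<phi> where "\<phi> \<rho> = tan (\<theta> (S \<rho>))" for \<rho>
  have w': "(w has_real_derivative \<phi> \<rho>) (at \<rho>)" if "\<rho> > R" for \<rho>
    using DERIV_chain2[OF z' S'[OF that]] unfolding w_def[abs_def] \<phi>_def tan_def
    by (simp add: field_simps)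
  have \<phi>': "(\<phi> has_real_derivative (1 + (\<phi> \<rho>)\<^sup>2) * (1 - m * \<phi> \<rho> / \<rho>)) (at \<rho>)" if "\<rho> > R" for \<rho>
  proof -
    let ?c = "cos (\<theta> (S \<rho>))" and ?s = "sin (\<theta> (S \<rho>))"
    have c: "?c > 0" using cos_pos[OF S_pos[OF that]] .
    have "(\<phi> has_real_derivative inverse (?c\<^sup>2) * ((?c - m * ?s / r (S \<rho>)) * inverse ?c)) (at \<rho>)"
      unfolding \<phi>_def[abs_def]
      using c by (intro DERIV_chain2[OF DERIV_tan] DERIV_chain2[OF \<theta>'] S' that) auto
    moreover have "inverse (?c\<^sup>2) = 1 + (\<phi> \<rho>)\<^sup>2"
      using c tan_sec[of "\<theta> (S \<rho>)"] by (simp add: \<phi>_def power_inverse)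
    moreover have "(?c - m * ?s / r (S \<rho>)) * inverse ?c = 1 - m * \<phi> \<rho> / \<rho>"
      using c r_S[of \<rho>] that R by (simp add: \<phi>_def tan_def field_simps)
    ultimately show ?thesis by simp
  qed
  have \<theta>S: "((\<lambda>\<rho>. \<theta> (S \<rho>)) \<longlongrightarrow> \<theta> 0) (at_right R)"
  proof -
    have "isCont (\<lambda>\<rho>. \<theta> (S \<rho>)) R"
      by (rule isCont_o2[OF S_cont DERIV_isCont[OF \<theta>']])
    then show ?thesis
      unfolding isCont_def S0 by (rule tendsto_mono[OF at_le, rotated]) simp
  qed
  have ev: "eventually (\<lambda>\<rho>. \<rho> > R) (at_right R)"
    by (simp add: eventually_at_right_less)
  show thesis
  proof (rule that[of w \<phi>])
    show "w (r s) = z s" if "s \<ge> 0" for s using that by (simp add: w_def S_r)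
    show "continuous_on {R..} w"
      unfolding w_def using S_cont
      by (intro continuous_on_compose2[OF z_cont[of UNIV]] continuous_at_imp_continuous_on) auto
    show "filterlim \<phi> at_top (at_right R)" if "\<theta> 0 = pi / 2"
    proof -
      have "filterlim (\<lambda>\<rho>. \<theta> (S \<rho>)) (at_left (pi / 2)) (at_right R)"
        unfolding filterlim_at
      proof
        show "\<forall>\<^sub>F \<rho> in at_right R. \<theta> (S \<rho>) \<in> {..<pi / 2} \<and> \<theta> (S \<rho>) \<noteq> pi / 2"
          using ev by eventually_elim (use \<theta>[OF S_pos] in force)
        show "((\<lambda>\<rho>. \<theta> (S \<rho>)) \<longlongrightarrow> pi / 2) (at_right R)"
          using \<theta>S that by simp
      qed
      then show ?thesis
        unfolding \<phi>_def by (rule filterlim_compose[OF filterlim_tan_at_left])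
    qed
    show "filterlim \<phi> at_bot (at_right R)" if "\<theta> 0 = - pi / 2"
    proof -
      have "filterlim (\<lambda>\<rho>. \<theta> (S \<rho>)) (at_right (- (pi / 2))) (at_right R)"
        unfolding filterlim_at
      proof
        show "\<forall>\<^sub>F \<rho> in at_right R. \<theta> (S \<rho>) \<in> {- (pi / 2)<..} \<and> \<theta> (S \<rho>) \<noteq> - (pi / 2)"
          using ev by eventually_elim (use \<theta>[OF S_pos] in force)
        show "((\<lambda>\<rho>. \<theta> (S \<rho>)) \<longlongrightarrow> - (pi / 2)) (at_right R)"
          using \<theta>S that by simp
      qed
      then show ?thesis
        unfolding \<phi>_def by (rule filterlim_compose[OF filterlim_tan_at_right])
    qed
  qed (use surj w' \<phi>' in auto)
qed

text \<open>The difference of the slopes solves a linear homogeneous equation and so keeps its sign.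
  The comparison starts at a point \<open>a\<close> slightly beyond \<open>R\<close>, since at
  \<open>R\<close> both slopes are infinite; the heights are then compared from their common value
  at \<open>R\<close>.\<close>

lemma wings_ordered:
  fixes w v \<phi> \<psi> :: "real \<Rightarrow> real"
  assumes R: "R > 0"
    and w: "continuous_on {R..} w" "\<And>\<rho>. \<rho> > R \<Longrightarrow> (w has_real_derivative \<phi> \<rho>) (at \<rho>)"
      "\<And>\<rho>. \<rho> > R \<Longrightarrow> (\<phi> has_real_derivative (1 + (\<phi> \<rho>)\<^sup>2) * (1 - m * \<phi> \<rho> / \<rho>)) (at \<rho>)"
    and v: "continuous_on {R..} v" "\<And>\<rho>. \<rho> > R \<Longrightarrow> (v has_real_derivative \<psi> \<rho>) (at \<rho>)"
      "\<And>\<rho>. \<rho> > R \<Longrightarrow> (\<psi> has_real_derivative (1 + (\<psi> \<rho>)\<^sup>2) * (1 - m * \<psi> \<rho> / \<rho>)) (at \<rho>)"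
    and lim: "filterlim \<phi> at_top (at_right R)" "filterlim \<psi> at_bot (at_right R)"
    and R_eq: "w R = v R" and \<rho>: "\<rho> > R"
  shows "w \<rho> > v \<rho>"
proof -
  have slope: "\<phi> x > \<psi> x" if x: "x > R" for x
  proof -
    have "eventually (\<lambda>a. \<phi> a > 0) (at_right R)" "eventually (\<lambda>a. \<psi> a < 0) (at_right R)"
      using lim by (auto simp: filterlim_at_top_dense filterlim_at_bot_dense)
    moreover have "eventually (\<lambda>a. a \<in> {R<..<x}) (at_right R)"
      using x by (rule eventually_at_right_real)
    ultimately have "eventually (\<lambda>a. \<phi> a > 0 \<and> \<psi> a < 0 \<and> a \<in> {R<..<x}) (at_right R)"
      by eventually_elim auto
    then obtain a where a: "\<phi> a > 0" "\<psi> a < 0" "R < a" "a < x"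
      using eventually_happens[of _ "at_right R"] by (auto simp: trivial_limit_at_right_real)
    \<comment> \<open>\<open>Q\<close> is the difference quotient of the cubic right-hand side of
      the slope equation between \<open>\<psi> t\<close> and \<open>\<phi> t\<close>, so
      \<open>exp (- P t)\<close> is an integrating factor for the difference of the slopes.\<close>
    define Q where "Q t = \<phi> t + \<psi> t - m / t * (1 + (\<phi> t)\<^sup>2 + \<phi> t * \<psi> t + (\<psi> t)\<^sup>2)" for t
    have "continuous_on {a..x} \<phi>" "continuous_on {a..x} \<psi>"
      using a by (auto intro!: continuous_at_imp_continuous_on DERIV_isCont w(3) v(3))
    then have "continuous_on {a..x} Q"
      unfolding Q_def using a R by (auto intro!: continuous_intros)
    then obtain P where P: "\<And>t. t \<in> {a..x} \<Longrightarrow> (P has_vector_derivative Q t) (at t within {a..x})"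
      using antiderivative_continuous by blast
    have P': "(P has_real_derivative Q t) (at t)" if "a < t" "t < x" for t
      using P[of t] that at_within_interior[of t "{a..x}"]
      by (simp add: has_real_derivative_iff_has_vector_derivative)
    have "(\<phi> x - \<psi> x) * exp (- P x) = (\<phi> a - \<psi> a) * exp (- P a)"
    proof (rule DERIV_isconst_end[OF \<open>a < x\<close>])
      show "continuous_on {a..x} (\<lambda>t. (\<phi> t - \<psi> t) * exp (- P t))"
        using continuous_on_vector_derivative[OF P] \<open>continuous_on {a..x} \<phi>\<close> \<open>continuous_on {a..x} \<psi>\<close>
        by (intro continuous_intros) auto
      fix t assume t: "a < t" "t < x"
      have "((\<lambda>t. (\<phi> t - \<psi> t) * exp (- P t)) has_real_derivative
          ((1 + (\<phi> t)\<^sup>2) * (1 - m * \<phi> t / t) - (1 + (\<psi> t)\<^sup>2) * (1 - m * \<psi> t / t)) * exp (- P t)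
          + (exp (- P t) * - Q t) * (\<phi> t - \<psi> t)) (at t)"
        using t a by (intro DERIV_mult DERIV_diff w(3) v(3) DERIV_fun_exp DERIV_minus P') auto
      moreover have "(1 + (\<phi> t)\<^sup>2) * (1 - m * \<phi> t / t) - (1 + (\<psi> t)\<^sup>2) * (1 - m * \<psi> t / t) =
          Q t * (\<phi> t - \<psi> t)"
        using t a R by (simp add: Q_def field_simps power2_eq_square)
      ultimately show "((\<lambda>t. (\<phi> t - \<psi> t) * exp (- P t)) has_real_derivative 0) (at t)"
        by (simp add: mult_ac)
    qed
    moreover have "(\<phi> a - \<psi> a) * exp (- P a) > 0" using a by simp
    ultimately have "(\<phi> x - \<psi> x) * exp (- P x) > 0" by (simp only:)
    then show ?thesis by (simp add: zero_less_mult_iff)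
  qed
  have "w R - v R < w \<rho> - v \<rho>"
  proof (rule DERIV_pos_imp_increasing_open[OF \<rho>])
    show "\<exists>y. ((\<lambda>x. w x - v x) has_real_derivative y) (at x) \<and> y > 0" if "R < x" "x < \<rho>" for x
      using that slope[of x] by (intro exI[of _ "\<phi> x - \<psi> x"]) (auto intro!: derivative_intros w v)
    show "continuous_on {R..\<rho>} (\<lambda>x. w x - v x)"
      using w(1) v(1) by (auto intro!: continuous_intros intro: continuous_on_subset)
  qed
  with R_eq show ?thesis by simp
qed

section \<open>Local equations and mean curvature\<close>

lemma has_derivative_radial:
  fixes x :: "'a::real_inner"
  assumes "x \<noteq> 0" "(f has_real_derivative d) (at (norm x))"
  shows "((\<lambda>y. f (norm y)) has_derivative (\<lambda>h. d * (x \<bullet> h) / norm x)) (at x)"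
proof -
  have "((\<lambda>y. f (norm y)) has_derivative (\<lambda>h. d * (h \<bullet> sgn x))) (at x)"
    using assms(2) unfolding has_field_derivative_def
    by (rule has_derivative_compose[OF has_derivative_norm[OF assms(1)]])
  then show ?thesis
    by (simp add: sgn_div_norm inner_commute divide_inverse mult_ac)
qed

lemma has_derivative_radial_fst:
  fixes q :: "'a::real_inner \<times> 'b::real_normed_vector"
  assumes "fst q \<noteq> 0" "(f has_real_derivative d) (at (norm (fst q)))"
  shows "((\<lambda>q. f (norm (fst q))) has_derivative (\<lambda>h. d * (fst q \<bullet> fst h) / norm (fst q))) (at q)"
  using has_derivative_compose[OF has_derivative_fst[OF has_derivative_ident] has_derivative_radial[OF assms]] .

lemma has_derivative_snd_diff:
  fixes q :: "'a::real_normed_vector \<times> real"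
  assumes "(f has_real_derivative d) (at (snd q - t))"
  shows "((\<lambda>q. f (snd q - t)) has_derivative (\<lambda>h. d * snd h)) (at q)"
proof -
  have "((\<lambda>q. snd q - t) has_derivative snd) (at q)"
    by (auto intro!: derivative_eq_intros)
  from has_derivative_compose[OF this assms[unfolded has_field_derivative_def]]
  show ?thesis .
qed

lemma divergence_radial:
  fixes x :: "'a::euclidean_space"
  assumes "x \<noteq> 0" "(f has_real_derivative d) (at (norm x))"
  shows "divergence (\<lambda>y. f (norm y) *\<^sub>R y) x = d * norm x + real DIM('a) * f (norm x)"
proof -
  have "((\<lambda>y. f (norm y) *\<^sub>R y) has_derivative
      (\<lambda>h. f (norm x) *\<^sub>R h + (d * (x \<bullet> h) / norm x) *\<^sub>R x)) (at x)"
    by (intro has_derivative_scaleR has_derivative_radial assms has_derivative_ident)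
  then have "divergence (\<lambda>y. f (norm y) *\<^sub>R y) x =
      (\<Sum>b\<in>Basis. (f (norm x) *\<^sub>R b + (d * (x \<bullet> b) / norm x) *\<^sub>R x) \<bullet> b)"
    by (rule divergence_eqI)
  also have "\<dots> = (\<Sum>b\<in>(Basis::'a set). f (norm x) + d / norm x * ((x \<bullet> b) * (x \<bullet> b)))"
    by (intro sum.cong) (auto simp: inner_add_left)
  also have "\<dots> = real DIM('a) * f (norm x) + d / norm x * (x \<bullet> x)"
    by (simp only: sum.distrib sum_distrib_left[symmetric] euclidean_inner[of x x, symmetric] sum_constant of_nat_mult)
  also have "\<dots> = d * norm x + real DIM('a) * f (norm x)"
    using assms(1) by (simp add: dot_square_norm power2_eq_square)
  finally show ?thesis .
qed

text \<open>The unit normals of the wing and neck charts have this form. By the product rule only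
  the derivative of \<open>a\<close> along the horizontal position vector and that of
  \<open>b\<close> in the vertical direction are needed, which spares coordinates.\<close>

lemma divergence_radial_vertical:
  fixes q :: "'a::euclidean_space \<times> real"
  assumes A: "(a has_derivative A) (at q)" and B: "(b has_derivative B) (at q)"
  shows "divergence (\<lambda>q. (a q *\<^sub>R fst q, b q)) q = A (fst q, 0) + real DIM('a) * a q + B (0, 1)"
proof -
  interpret A: bounded_linear A using A by (rule has_derivative_bounded_linear)
  have "((\<lambda>q. (a q *\<^sub>R fst q, b q)) has_derivative (\<lambda>h. (a q *\<^sub>R fst h + A h *\<^sub>R fst q, B h))) (at q)"
    by (intro has_derivative_Pair has_derivative_scaleR A B has_derivative_fst has_derivative_ident)
  then have "divergence (\<lambda>q. (a q *\<^sub>R fst q, b q)) q =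
      (\<Sum>h\<in>Basis. (a q *\<^sub>R fst h + A h *\<^sub>R fst q, B h) \<bullet> h)"
    by (rule divergence_eqI)
  also have "\<dots> = (\<Sum>k\<in>(Basis::'a set). a q + A ((fst q \<bullet> k) *\<^sub>R (k, 0))) + B (0, 1)"
    unfolding sum_Basis_prod A.scaleR
    by (simp add: inner_add_left mult.commute)
  also have "\<dots> = real DIM('a) * a q + A (\<Sum>k\<in>Basis. (fst q \<bullet> k) *\<^sub>R (k, 0)) + B (0, 1)"
    by (simp only: sum.distrib A.sum sum_constant)
  also have "(\<Sum>k\<in>Basis. (fst q \<bullet> k) *\<^sub>R (k, 0::real)) = (fst q, 0)"
    by (simp add: prod_eq_iff fst_sum snd_sum euclidean_representation)
  finally show ?thesis by simp
qed

lemma sqrt_one_plus_sq_deriv: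
  assumes "(f has_real_derivative d) (at x)"
  shows "((\<lambda>x. sqrt (1 + (f x)\<^sup>2)) has_real_derivative f x * d / sqrt (1 + (f x)\<^sup>2)) (at x)"
proof -
  have pos: "1 + (f x)\<^sup>2 > 0" by (smt (verit) zero_le_power2)
  have "((\<lambda>x. 1 + (f x)\<^sup>2) has_real_derivative 2 * (f x * d)) (at x)"
    using DERIV_add[OF DERIV_const[of 1] DERIV_power[OF assms, of 2]] by (simp add: mult_ac)
  note chain = DERIV_chain2[OF DERIV_real_sqrt[OF pos] this]
  have "inverse s / 2 * (2 * (f x * d)) = f x * d / s" for s :: real
    by (simp add: field_simps)
  then show ?thesis by (rule DERIV_cong[OF chain])
qed

lemma inverse_sqrt_one_plus_sq_deriv:
  assumes "(f has_real_derivative d) (at x)"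
  shows "((\<lambda>x. 1 / sqrt (1 + (f x)\<^sup>2)) has_real_derivative - (f x * d / sqrt (1 + (f x)\<^sup>2) ^ 3)) (at x)"
proof -
  define s where "s x = sqrt (1 + (f x)\<^sup>2)" for x
  have "s x \<noteq> 0" unfolding s_def by (smt (verit) zero_le_power2 real_sqrt_gt_zero)
  moreover from this have "((\<lambda>x. 1 / s x) has_real_derivative (0 * s x - 1 * (f x * d / s x)) / (s x * s x)) (at x)"
    using sqrt_one_plus_sq_deriv[OF assms] unfolding s_def[symmetric]
    by (intro DERIV_divide DERIV_const)
  ultimately have "((\<lambda>x. 1 / s x) has_real_derivative - (f x * d / s x ^ 3)) (at x)"
    by (simp add: power3_eq_cube mult.assoc)
  then show ?thesis by (simp only: s_def)
qed

text \<open>For a graph with slope \<open>\<phi>\<close>, the factor \<open>\<phi> / (\<rho> sqrt (1 + \<phi>\<^sup>2))\<close> times the position vector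
  is the radial part of the downward unit normal; the second fact is its divergence in \<open>m + 1\<close>
  dimensions.\<close>

lemma radial_normal_deriv:
  fixes \<phi> :: "real \<Rightarrow> real"
  assumes "\<rho> > 0"
    and "(\<phi> has_real_derivative (1 + (\<phi> \<rho>)\<^sup>2) * (1 - m * \<phi> \<rho> / \<rho>)) (at \<rho>)"
  obtains d where
    "((\<lambda>\<rho>. \<phi> \<rho> / (\<rho> * sqrt (1 + (\<phi> \<rho>)\<^sup>2))) has_real_derivative d) (at \<rho>)"
    "d * \<rho> + (m + 1) * (\<phi> \<rho> / (\<rho> * sqrt (1 + (\<phi> \<rho>)\<^sup>2))) = 1 / sqrt (1 + (\<phi> \<rho>)\<^sup>2)"
proof -
  define D where "D = sqrt (1 + (\<phi> \<rho>)\<^sup>2)"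
  define p where "p = (1 + (\<phi> \<rho>)\<^sup>2) * (1 - m * \<phi> \<rho> / \<rho>)"
  have D: "D > 0" unfolding D_def by (smt (verit) zero_le_power2 real_sqrt_gt_zero)
  have D2: "(\<phi> \<rho>)\<^sup>2 = D\<^sup>2 - 1" by (simp add: D_def)
  define d where "d = (p * (\<rho> * D) - \<phi> \<rho> * (D + \<rho> * (\<phi> \<rho> * p / D))) / (\<rho> * D)\<^sup>2"
  have "((\<lambda>\<rho>. \<phi> \<rho> / (\<rho> * sqrt (1 + (\<phi> \<rho>)\<^sup>2))) has_real_derivative d) (at \<rho>)"
    unfolding d_def D_def p_def
    using DERIV_divide[OF assms(2) DERIV_mult[OF DERIV_ident sqrt_one_plus_sq_deriv[OF assms(2)]]]
      assms(1) D by (simp add: D_def power2_eq_square mult_ac)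
  moreover have "d * \<rho> + (m + 1) * (\<phi> \<rho> / (\<rho> * D)) = 1 / D"
  proof -
    have "p * (\<rho> * D) - \<phi> \<rho> * (D + \<rho> * (\<phi> \<rho> * p / D)) = p * \<rho> * (D\<^sup>2 - (\<phi> \<rho>)\<^sup>2) / D - \<phi> \<rho> * D"
      using D by (simp add: field_simps power2_eq_square)
    also have "\<dots> = p * \<rho> / D - \<phi> \<rho> * D" by (simp add: D2)
    finally have "d = (p * \<rho> / D - \<phi> \<rho> * D) / (\<rho> * D)\<^sup>2"
      by (simp only: d_def)
    moreover have "p = D\<^sup>2 * (1 - m * \<phi> \<rho> / \<rho>)" by (simp add: p_def D2)
    ultimately have "d = (D\<^sup>2 * (1 - m * \<phi> \<rho> / \<rho>) * \<rho> / D - \<phi> \<rho> * D) / (\<rho> * D)\<^sup>2"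
      by simp
    also have "D\<^sup>2 * (1 - m * \<phi> \<rho> / \<rho>) * \<rho> / D - \<phi> \<rho> * D = D * (\<rho> - m * \<phi> \<rho> - \<phi> \<rho>)"
      using D assms(1) by (simp add: field_simps power2_eq_square)
    finally have "d = (\<rho> - m * \<phi> \<rho> - \<phi> \<rho>) / (\<rho>\<^sup>2 * D)"
      using D by (simp add: power2_eq_square)
    then show ?thesis
      using D assms(1) by (simp add: field_simps power2_eq_square)
  qed
  ultimately show thesis using that[of d] by (simp add: D_def)
qed

text \<open>The slope equation makes the algebra generated by linear functions, \<open>w\<close>,
  \<open>\<phi>\<close> and the reciprocal radius closed under differentiation. The coefficients let
  one statement serve both the defining function of a wing (1, -1, \<open>- t\<close>) and the
  solution on space-time (1, 1, 0).\<close>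

lemma smooth_on_wing:
  fixes w \<phi> :: "real \<Rightarrow> real"
  assumes R: "R > 0"
    and w': "\<And>\<rho>. \<rho> > R \<Longrightarrow> (w has_real_derivative \<phi> \<rho>) (at \<rho>)"
    and \<phi>': "\<And>\<rho>. \<rho> > R \<Longrightarrow> (\<phi> has_real_derivative (1 + (\<phi> \<rho>)\<^sup>2) * (1 - m * \<phi> \<rho> / \<rho>)) (at \<rho>)"
  shows "smooth_on {q :: 'a::euclidean_space \<times> real. norm (fst q) > R}
           (\<lambda>q. \<alpha> * snd q + \<beta> * w (norm (fst q)) + \<gamma>)"
proof -
  define G where "G = range (\<lambda>v q :: 'a \<times> real. q \<bullet> v) \<union>
    {\<lambda>q. w (norm (fst q)), \<lambda>q. \<phi> (norm (fst q)), \<lambda>q. 1 / norm (fst q)}"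
  let ?S = "{q :: 'a \<times> real. norm (fst q) > R}"
  have ne: "fst q \<noteq> 0" if "q \<in> ?S" for q using that R by auto
  have lin: "(\<lambda>q. q \<bullet> v) \<in> generated_algebra G" for v
    by (auto intro: generated_algebra.gen simp: G_def)
  have fst_lin: "(\<lambda>q. fst q \<bullet> v) \<in> generated_algebra G" for v
    using lin[of "(v, 0)"] by (simp add: inner_prod_def)
  have snd_lin: "snd \<in> generated_algebra G"
    using lin[of "(0, 1)"] by (simp add: inner_prod_def)
  have gens: "(\<lambda>q. w (norm (fst q))) \<in> generated_algebra G"
    "(\<lambda>q. \<phi> (norm (fst q))) \<in> generated_algebra G" "(\<lambda>q. 1 / norm (fst q)) \<in> generated_algebra G"
    by (auto intro: generated_algebra.gen simp: G_def)
  have divide: "(\<lambda>q. f q / norm (fst q)) \<in> generated_algebra G" if "f \<in> generated_algebra G" for f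
    using generated_algebra.mult[OF that gens(3)] by simp
  note alg = generated_algebra_intros fst_lin snd_lin gens divide
  show ?thesis
  proof (rule smooth_on_generated_algebra)
    show "open ?S" by (intro open_Collect_less continuous_intros)
    show "(\<lambda>q. \<alpha> * snd q + \<beta> * w (norm (fst q)) + \<gamma>) \<in> generated_algebra G"
      by (intro alg)
    fix g assume "g \<in> G"
    then consider v where "g = (\<lambda>q. q \<bullet> v)" | "g = (\<lambda>q. w (norm (fst q)))" |
      "g = (\<lambda>q. \<phi> (norm (fst q)))" | "g = (\<lambda>q. 1 / norm (fst q))"
      by (auto simp: G_def)
    then show "\<exists>D. (\<forall>q\<in>?S. (g has_derivative D q) (at q)) \<and> (\<forall>v. (\<lambda>q. D q v) \<in> generated_algebra G)"
    proof cases
      case 1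
      then show ?thesis
        by (intro exI[of _ "\<lambda>_ h. h \<bullet> v"]) (auto intro!: derivative_eq_intros alg)
    next
      case 2
      show ?thesis unfolding 2
        by (intro exI[of _ "\<lambda>q h. \<phi> (norm (fst q)) * (fst q \<bullet> fst h) / norm (fst q)"]
            conjI ballI allI alg has_derivative_radial_fst[OF ne w']) auto
    next
      case 3
      have "(\<lambda>q. (1 + (\<phi> (norm (fst q)))\<^sup>2) * (1 - m * \<phi> (norm (fst q)) / norm (fst q)) * (fst q \<bullet> fst h) / norm (fst q))
          \<in> generated_algebra G" for h :: "'a \<times> real"
        unfolding power2_eq_square by (intro alg)
      then show ?thesis unfolding 3
        by (intro exI[of _ "\<lambda>q h. (1 + (\<phi> (norm (fst q)))\<^sup>2) * (1 - m * \<phi> (norm (fst q)) / norm (fst q))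
            * (fst q \<bullet> fst h) / norm (fst q)"] conjI ballI has_derivative_radial_fst[OF ne \<phi>']) auto
    next
      case 4
      have "((\<lambda>\<rho>. 1 / \<rho>) has_real_derivative - (1 / \<rho> / \<rho>)) (at \<rho>)" if "\<rho> \<noteq> 0" for \<rho> :: real
        using that by (auto intro!: derivative_eq_intros)
      then show ?thesis unfolding 4
        by (intro exI[of _ "\<lambda>q h. - (1 / norm (fst q) / norm (fst q)) * (fst q \<bullet> fst h) / norm (fst q)"]
            conjI ballI allI alg has_derivative_radial_fst[OF ne]) (use ne in auto)
    qed
  qed
qed

lemma has_derivative_unit_normal:
  assumes "open U" "p \<in> U" "\<And>q. q \<in> U \<Longrightarrow> unit_normal F q = N q" "(N has_derivative D) (at p)"
  shows "(unit_normal F has_derivative D) (at p)"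
  using has_derivative_transform_within_open[OF assms(4,1,2)] assms(3) by simp

text \<open>With one local equation used for both notions, each vector is a multiple of the same
  unit normal, and the scalar hypothesis equates the two coefficients.\<close>

lemma translator_equation_at:
  fixes M :: "('a::euclidean_space \<times> real) set"
  assumes "local_equation M U F" "p \<in> U"
    and "divergence (unit_normal F) p = - ((0, 1) \<bullet> unit_normal F p)"
  shows "\<exists>H. has_mean_curvature_vector M p H \<and> is_normal_component M p (0, 1) H"
  unfolding has_mean_curvature_vector_def is_normal_component_def
  using assms by (intro exI conjI) auto

lemma wing_unit_normal:
  fixes q :: "'a::euclidean_space \<times> real"
  assumes "fst q \<noteq> 0" "(w has_real_derivative \<phi>) (at (norm (fst q)))"
  shows "grad (\<lambda>q. snd q - w (norm (fst q)) - t) q = (- (\<phi> / norm (fst q)) *\<^sub>R fst q, 1)"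
    and "unit_normal (\<lambda>q. snd q - w (norm (fst q)) - t) q =
      (- (\<phi> / (norm (fst q) * sqrt (1 + \<phi>\<^sup>2))) *\<^sub>R fst q, 1 / sqrt (1 + \<phi>\<^sup>2))"
proof -
  have "((\<lambda>q. snd q - w (norm (fst q)) - t) has_derivative
      (\<lambda>h. snd h - \<phi> * (fst q \<bullet> fst h) / norm (fst q) - 0)) (at q)"
    by (intro has_derivative_diff has_derivative_radial_fst assms has_derivative_const
        has_derivative_snd has_derivative_ident)
  then show g: "grad (\<lambda>q. snd q - w (norm (fst q)) - t) q = (- (\<phi> / norm (fst q)) *\<^sub>R fst q, 1)"
    by (intro grad_eqI) (simp add: inner_prod_def)
  have "norm (- (\<phi> / norm (fst q)) *\<^sub>R fst q, 1::real) = sqrt (1 + \<phi>\<^sup>2)"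
    using assms(1) by (simp add: norm_prod_def power_divide power_mult_distrib add.commute)
  then show "unit_normal (\<lambda>q. snd q - w (norm (fst q)) - t) q =
      (- (\<phi> / (norm (fst q) * sqrt (1 + \<phi>\<^sup>2))) *\<^sub>R fst q, 1 / sqrt (1 + \<phi>\<^sup>2))"
    unfolding unit_normal_def g by (simp add: field_simps)
qed

text \<open>Here \<open>v\<close> is the height of the other wing; deleting its graph leaves a
  single sheet of \<open>M\<close> in \<open>U\<close>, and continuity of \<open>v\<close> keeps
  \<open>U\<close> open. The normal does not depend on the height, so the curvature identity holds
  on all of \<open>U\<close> and not only on \<open>M\<close>.\<close>

lemma wing_chart:
  fixes w \<phi> v :: "real \<Rightarrow> real" and M :: "('a::euclidean_space \<times> real) set"
  assumes R: "R > 0" and m: "m = real DIM('a) - 1"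
    and w': "\<And>\<rho>. \<rho> > R \<Longrightarrow> (w has_real_derivative \<phi> \<rho>) (at \<rho>)"
    and \<phi>': "\<And>\<rho>. \<rho> > R \<Longrightarrow> (\<phi> has_real_derivative (1 + (\<phi> \<rho>)\<^sup>2) * (1 - m * \<phi> \<rho> / \<rho>)) (at \<rho>)"
    and v: "continuous_on {R..} v"
    and U: "U = {q. norm (fst q) > R \<and> snd q - t \<noteq> v (norm (fst q))}"
    and F: "F = (\<lambda>q. snd q - w (norm (fst q)) - t)"
    and M: "\<And>q. q \<in> U \<Longrightarrow> q \<in> M \<longleftrightarrow> snd q - t = w (norm (fst q))"
  shows "local_equation M U F"
    and "\<And>q. q \<in> U \<Longrightarrow> divergence (unit_normal F) q = - ((0, 1) \<bullet> unit_normal F q)"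
proof -
  let ?S = "{q :: 'a \<times> real. norm (fst q) > R}"
  have S: "open ?S" by (intro open_Collect_less continuous_intros)
  have "continuous_on ?S (\<lambda>q. snd q - t - v (norm (fst q)))"
    by (intro continuous_intros continuous_on_compose2[OF v]) auto
  then have "open (?S \<inter> (\<lambda>q. snd q - t - v (norm (fst q))) -` (- {0}))"
    using S by (rule continuous_open_preimage) auto
  also have "?S \<inter> (\<lambda>q. snd q - t - v (norm (fst q))) -` (- {0}) = U"
    by (auto simp: U)
  finally have oU: "open U" .
  have US: "U \<subseteq> ?S" by (auto simp: U)
  have ne: "fst q \<noteq> 0" if "q \<in> ?S" for q using that R by auto
  have "smooth_on ?S F"
    using smooth_on_wing[OF R w' \<phi>', where \<alpha> = 1 and \<beta> = "-1" and \<gamma> = "- t"] by (simp add: F)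
  moreover have "grad F q \<noteq> 0" if "q \<in> U" for q
    unfolding F using wing_unit_normal(1)[OF ne w', of q t] that US by (auto simp: prod_eq_iff)
  ultimately show "local_equation M U F"
    unfolding local_equation_def using oU US M by (auto intro: smooth_on_subset simp: F)
  fix p assume p: "p \<in> U"
  define \<rho> where "\<rho> = norm (fst p)"
  have \<rho>: "\<rho> > R" "\<rho> > 0" using p R by (auto simp: U \<rho>_def)
  let ?a = "\<lambda>\<rho>. \<phi> \<rho> / (\<rho> * sqrt (1 + (\<phi> \<rho>)\<^sup>2))"
  define N where "N q = (- ?a (norm (fst q)) *\<^sub>R fst q, 1 / sqrt (1 + (\<phi> (norm (fst q)))\<^sup>2))" for q :: "'a \<times> real"
  have N: "unit_normal F q = N q" if "q \<in> U" for q
    unfolding F N_def using that US by (intro wing_unit_normal(2) ne w') auto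
  obtain d where d: "(?a has_real_derivative d) (at \<rho>)"
    "d * \<rho> + (m + 1) * ?a \<rho> = 1 / sqrt (1 + (\<phi> \<rho>)\<^sup>2)"
    using radial_normal_deriv[OF \<rho>(2) \<phi>'[OF \<rho>(1)]] by blast
  have A: "((\<lambda>q. - ?a (norm (fst q))) has_derivative (\<lambda>h. - (d * (fst p \<bullet> fst h) / norm (fst p)))) (at p)"
    using d(1) ne[of p] p US by (intro has_derivative_minus has_derivative_radial_fst) (auto simp: \<rho>_def)
  have B: "((\<lambda>q. 1 / sqrt (1 + (\<phi> (norm (fst q)))\<^sup>2)) has_derivative (\<lambda>h.
      - (\<phi> \<rho> * ((1 + (\<phi> \<rho>)\<^sup>2) * (1 - m * \<phi> \<rho> / \<rho>)) / sqrt (1 + (\<phi> \<rho>)\<^sup>2) ^ 3) * (fst p \<bullet> fst h) / norm (fst p))) (at p)"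
    using ne[of p] p US \<rho> unfolding \<rho>_def
    by (intro has_derivative_radial_fst inverse_sqrt_one_plus_sq_deriv \<phi>') auto
  have "(N has_derivative (\<lambda>h. (- ?a (norm (fst p)) *\<^sub>R fst h + - (d * (fst p \<bullet> fst h) / norm (fst p)) *\<^sub>R fst p,
      - (\<phi> \<rho> * ((1 + (\<phi> \<rho>)\<^sup>2) * (1 - m * \<phi> \<rho> / \<rho>)) / sqrt (1 + (\<phi> \<rho>)\<^sup>2) ^ 3) * (fst p \<bullet> fst h) / norm (fst p)))) (at p)"
    unfolding N_def by (intro has_derivative_Pair has_derivative_scaleR A B has_derivative_fst has_derivative_ident)
  note DN = this
  have "divergence (unit_normal F) p = divergence N p"
    using divergence_eqI[OF has_derivative_unit_normal[OF oU p N DN]] divergence_eqI[OF DN] by simp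
  \<comment> \<open>The vertical component of \<open>N\<close> depends on the radius alone and
    contributes nothing to the divergence.\<close>
  also have "\<dots> = - (d * \<rho> + (m + 1) * ?a \<rho>)"
    unfolding N_def divergence_radial_vertical[OF A B]
    using \<rho> by (simp add: m dot_square_norm power2_eq_square flip: \<rho>_def)
  also have "\<dots> = - ((0, 1) \<bullet> N p)"
    unfolding d(2) by (simp add: N_def inner_prod_def \<rho>_def)
  finally show "divergence (unit_normal F) p = - ((0, 1) \<bullet> unit_normal F p)"
    by (simp add: N p)
qed

text \<open>The slope equation says that the divergence of the normalised gradient is the reciprocal
  of the area factor. The right-hand side of the flow equation is therefore 1, the time derivative
  of \<open>w (norm x) + t\<close>.\<close>

lemma wing_graphical_mcf:
  fixes w \<phi> :: "real \<Rightarrow> real"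
  assumes R: "R > 0" and m: "m = real DIM('a::euclidean_space) - 1"
    and w': "\<And>\<rho>. \<rho> > R \<Longrightarrow> (w has_real_derivative \<phi> \<rho>) (at \<rho>)"
    and \<phi>': "\<And>\<rho>. \<rho> > R \<Longrightarrow> (\<phi> has_real_derivative (1 + (\<phi> \<rho>)\<^sup>2) * (1 - m * \<phi> \<rho> / \<rho>)) (at \<rho>)"
  shows "graphical_mcf_on {x :: 'a. norm x > R} (\<lambda>x t. w (norm x) + t)"
    and "\<And>(x :: 'a) t. norm x > R \<Longrightarrow> norm (grad (\<lambda>z. w (norm z) + t) x) = \<bar>\<phi> (norm x)\<bar>"
proof -
  let ?S = "{x :: 'a. norm x > R}"
  have S: "open ?S" by (intro open_Collect_less continuous_intros)
  have g: "grad (\<lambda>z. w (norm z) + t) x = (\<phi> (norm x) / norm x) *\<^sub>R x" if "x \<in> ?S" for x :: 'a and t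
  proof -
    have "((\<lambda>z. w (norm z) + t) has_derivative (\<lambda>h. \<phi> (norm x) * (x \<bullet> h) / norm x + 0)) (at x)"
      using that R by (intro has_derivative_add has_derivative_radial w' has_derivative_const) auto
    then show ?thesis by (intro grad_eqI) simp
  qed
  show ng: "norm (grad (\<lambda>z. w (norm z) + t) x) = \<bar>\<phi> (norm x)\<bar>" if "norm x > R" for x :: 'a and t
  proof -
    have "x \<noteq> 0" using that R by auto
    then show ?thesis using that g[of x t] by simp
  qed
  let ?a = "\<lambda>\<rho>. \<phi> \<rho> / (\<rho> * sqrt (1 + (\<phi> \<rho>)\<^sup>2))"
  show "graphical_mcf_on ?S (\<lambda>x t. w (norm x) + t)"
    unfolding graphical_mcf_on_def
  proof (intro conjI ballI allI impI S exI)
    show "smooth_on (?S \<times> UNIV) (\<lambda>q. 1 * snd q + 1 * w (norm (fst q)) + 0)"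
      by (rule smooth_on_subset[OF smooth_on_wing[OF R w' \<phi>']]) auto
    show "1 * snd (x, t) + 1 * w (norm (fst (x, t))) + 0 = w (norm x) + t" for x :: 'a and t
      by simp
  next
    fix x :: 'a and t :: real
    assume x: "x \<in> ?S"
    let ?X = "\<lambda>y. grad (\<lambda>z. w (norm z) + t) y /\<^sub>R sqrt (1 + (norm (grad (\<lambda>z. w (norm z) + t) y))\<^sup>2)"
    have X: "?X y = ?a (norm y) *\<^sub>R y" if "y \<in> ?S" for y
    proof -
      have "norm y > R" using that by simp
      then show ?thesis unfolding ng g[OF that] by (simp add: field_simps)
    qed
    have nx: "norm x > R" "norm x > 0" using x R by auto
    obtain d where d: "(?a has_real_derivative d) (at (norm x))"
      "d * norm x + (m + 1) * ?a (norm x) = 1 / sqrt (1 + (\<phi> (norm x))\<^sup>2)"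
      using radial_normal_deriv[OF nx(2) \<phi>'[OF nx(1)]] by blast
    have x0: "x \<noteq> 0" using x R by auto
    have "divergence ?X x = divergence (\<lambda>y. ?a (norm y) *\<^sub>R y) x"
    proof -
      have "((\<lambda>y. ?a (norm y) *\<^sub>R y) has_derivative
          (\<lambda>h. ?a (norm x) *\<^sub>R h + (d * (x \<bullet> h) / norm x) *\<^sub>R x)) (at x)" (is "(_ has_derivative ?D) _")
        by (intro has_derivative_scaleR has_derivative_radial d x0 has_derivative_ident)
      moreover from this have "(?X has_derivative ?D) (at x)"
        by (rule has_derivative_transform_within_open[OF _ S x]) (use X in simp)
      ultimately show ?thesis by (simp only: divergence_eqI)
    qed
    also have "\<dots> = 1 / sqrt (1 + (\<phi> (norm x))\<^sup>2)"
      using divergence_radial[OF x0 d(1)] d(2) by (simp add: m)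
    finally have "divergence ?X x = 1 / sqrt (1 + (\<phi> (norm x))\<^sup>2)" .
    moreover have "sqrt (1 + (\<phi> (norm x))\<^sup>2) \<noteq> 0"
      by (smt (verit) zero_le_power2 real_sqrt_gt_zero)
    ultimately have "sqrt (1 + (norm (grad (\<lambda>z. w (norm z) + t) x))\<^sup>2) * divergence ?X x = 1"
      using x by (simp add: ng)
    then show "((\<lambda>t. w (norm x) + t) has_real_derivative
        sqrt (1 + (norm (grad (\<lambda>z. w (norm z) + t) x))\<^sup>2) * divergence ?X x) (at t within {0..})"
      by (auto intro!: derivative_eq_intros)
  qed
qed

section \<open>Charts at the neck\<close>

text \<open>Radius and height exchange roles: \<open>\<rho>\<close> gives the radius as a function
  of the height and \<open>c\<close> is its derivative. The equation for \<open>c\<close> contains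
  \<open>1 / \<rho>\<close>, which therefore joins the generators next to the reciprocal of the
  actual radius.\<close>

lemma smooth_on_neck:
  fixes \<rho> c :: "real \<Rightarrow> real"
  assumes I: "open I" and \<rho>_pos: "\<And>y. y \<in> I \<Longrightarrow> \<rho> y > 0"
    and \<rho>': "\<And>y. y \<in> I \<Longrightarrow> (\<rho> has_real_derivative c y) (at y)"
    and c': "\<And>y. y \<in> I \<Longrightarrow> (c has_real_derivative (1 + (c y)\<^sup>2) * (m / \<rho> y - c y)) (at y)"
  shows "smooth_on {q :: 'a::euclidean_space \<times> real. fst q \<noteq> 0 \<and> snd q - t \<in> I}
           (\<lambda>q. norm (fst q) - \<rho> (snd q - t))" 
    and "open {q :: 'a \<times> real. fst q \<noteq> 0 \<and> snd q - t \<in> I}"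
proof -
  let ?S = "{q :: 'a \<times> real. fst q \<noteq> 0 \<and> snd q - t \<in> I}"
  define G where "G = range (\<lambda>v q :: 'a \<times> real. q \<bullet> v) \<union>
    {\<lambda>q. norm (fst q), \<lambda>q. 1 / norm (fst q), \<lambda>q. \<rho> (snd q - t), \<lambda>q. c (snd q - t), \<lambda>q. 1 / \<rho> (snd q - t)}"
  have lin: "(\<lambda>q. q \<bullet> v) \<in> generated_algebra G" for v
    by (auto intro: generated_algebra.gen simp: G_def)
  have fst_lin: "(\<lambda>q. fst q \<bullet> v) \<in> generated_algebra G" for v
    using lin[of "(v, 0)"] by (simp add: inner_prod_def)
  have gens: "(\<lambda>q. norm (fst q)) \<in> generated_algebra G" "(\<lambda>q. 1 / norm (fst q)) \<in> generated_algebra G"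
    "(\<lambda>q. \<rho> (snd q - t)) \<in> generated_algebra G" "(\<lambda>q. c (snd q - t)) \<in> generated_algebra G"
    "(\<lambda>q. 1 / \<rho> (snd q - t)) \<in> generated_algebra G"
    by (auto intro: generated_algebra.gen simp: G_def)
  have divide: "(\<lambda>q. f q / norm (fst q)) \<in> generated_algebra G"
    "(\<lambda>q. f q / \<rho> (snd q - t)) \<in> generated_algebra G" if "f \<in> generated_algebra G" for f
    using generated_algebra.mult[OF that gens(2)] generated_algebra.mult[OF that gens(5)] by simp_all
  note alg = generated_algebra_intros fst_lin gens divide
  show S: "open ?S"
  proof -
    have "open {q :: 'a \<times> real. fst q \<noteq> 0}" by (intro open_Collect_neq continuous_intros)
    moreover have "open ((\<lambda>q :: 'a \<times> real. snd q - t) -` I)"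
      by (intro open_vimage I continuous_intros)
    ultimately have "open ({q :: 'a \<times> real. fst q \<noteq> 0} \<inter> (\<lambda>q. snd q - t) -` I)" by (rule open_Int)
    then show ?thesis by (simp add: Int_def vimage_def)
  qed
  show "smooth_on ?S (\<lambda>q. norm (fst q) - \<rho> (snd q - t))"
  proof (rule smooth_on_generated_algebra[OF S])
    show "(\<lambda>q. norm (fst q) - \<rho> (snd q - t)) \<in> generated_algebra G"
      by (intro alg)
    fix g assume "g \<in> G"
    then consider v where "g = (\<lambda>q. q \<bullet> v)" | "g = (\<lambda>q. norm (fst q))" | "g = (\<lambda>q. 1 / norm (fst q))" |
      "g = (\<lambda>q. \<rho> (snd q - t))" | "g = (\<lambda>q. c (snd q - t))" | "g = (\<lambda>q. 1 / \<rho> (snd q - t))"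
      by (auto simp: G_def)
    then show "\<exists>D. (\<forall>q\<in>?S. (g has_derivative D q) (at q)) \<and> (\<forall>v. (\<lambda>q. D q v) \<in> generated_algebra G)"
    proof cases
      case 1
      then show ?thesis
        by (intro exI[of _ "\<lambda>_ h. h \<bullet> v"]) (auto intro!: derivative_eq_intros alg)
    next
      case 2
      show ?thesis unfolding 2
        by (intro exI[of _ "\<lambda>q h. 1 * (fst q \<bullet> fst h) / norm (fst q)"]
            conjI ballI has_derivative_radial_fst DERIV_ident) (auto intro!: alg)
    next
      case 3
      have "((\<lambda>\<rho>. 1 / \<rho>) has_real_derivative - (1 / \<rho> / \<rho>)) (at \<rho>)" if "\<rho> \<noteq> 0" for \<rho> :: real
        using that by (auto intro!: derivative_eq_intros)
      then show ?thesis unfolding 3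
        by (intro exI[of _ "\<lambda>q h. - (1 / norm (fst q) / norm (fst q)) * (fst q \<bullet> fst h) / norm (fst q)"]
            conjI ballI allI alg has_derivative_radial_fst) auto
    next
      case 4
      show ?thesis unfolding 4
        by (intro exI[of _ "\<lambda>q h. c (snd q - t) * snd h"]
            conjI ballI has_derivative_snd_diff \<rho>') (auto intro!: alg)
    next
      case 5
      have "(\<lambda>q. (1 + (c (snd q - t))\<^sup>2) * (m / \<rho> (snd q - t) - c (snd q - t)) * snd v)
          \<in> generated_algebra G" for v :: "'a \<times> real"
        unfolding power2_eq_square by (intro alg)
      then show ?thesis unfolding 5
        by (intro exI[of _ "\<lambda>q h. (1 + (c (snd q - t))\<^sup>2) * (m / \<rho> (snd q - t) - c (snd q - t)) * snd h"]
            conjI ballI has_derivative_snd_diff c') auto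
    next
      case 6
      have "((\<lambda>y. 1 / \<rho> y) has_real_derivative - (c y / \<rho> y / \<rho> y)) (at y)" if "y \<in> I" for y
        using \<rho>_pos[OF that] \<rho>'[OF that] by (auto intro!: derivative_eq_intros)
      then show ?thesis unfolding 6
        by (intro exI[of _ "\<lambda>q h. - (c (snd q - t) / \<rho> (snd q - t) / \<rho> (snd q - t)) * snd h"]
            conjI ballI allI alg has_derivative_snd_diff) auto
    qed
  qed
qed

text \<open>The bound \<open>R'\<close> keeps out the parts of \<open>M\<close> that pass the same
  height farther from the axis. Other level sets of \<open>F\<close> are not translates of
  \<open>M\<close>, so the curvature identity is claimed only on \<open>M\<close>. The last two
  conclusions concern the waist \<open>c = 0\<close>, where the normal is horizontal, and are meant
  for reading off the principal curvatures.\<close>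

lemma neck_chart:
  fixes \<rho> c :: "real \<Rightarrow> real" and M :: "('a::euclidean_space \<times> real) set"
  assumes m: "m = real DIM('a) - 1"
    and I: "open I" and \<rho>_pos: "\<And>y. y \<in> I \<Longrightarrow> \<rho> y > 0"
    and \<rho>': "\<And>y. y \<in> I \<Longrightarrow> (\<rho> has_real_derivative c y) (at y)"
    and c': "\<And>y. y \<in> I \<Longrightarrow> (c has_real_derivative (1 + (c y)\<^sup>2) * (m / \<rho> y - c y)) (at y)"
    and U: "U = {q. fst q \<noteq> 0 \<and> norm (fst q) < R' \<and> snd q - t \<in> I}"
    and F: "F = (\<lambda>q. norm (fst q) - \<rho> (snd q - t))"
    and M: "\<And>q. q \<in> U \<Longrightarrow> q \<in> M \<longleftrightarrow> norm (fst q) = \<rho> (snd q - t)"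
  shows "local_equation M U F"
    and "\<And>q. q \<in> U \<Longrightarrow> q \<in> M \<Longrightarrow> divergence (unit_normal F) q = - ((0, 1) \<bullet> unit_normal F q)"
    and "\<And>q. q \<in> U \<Longrightarrow> c (snd q - t) = 0 \<Longrightarrow> unit_normal F q = ((1 / norm (fst q)) *\<^sub>R fst q, 0)"
    and "\<And>q h. q \<in> U \<Longrightarrow> c (snd q - t) = 0 \<Longrightarrow> frechet_derivative (unit_normal F) (at q) h =
      ((1 / norm (fst q)) *\<^sub>R fst h - (fst q \<bullet> fst h / norm (fst q) ^ 3) *\<^sub>R fst q, - (m / \<rho> (snd q - t) * snd h))"
proof -
  let ?S = "{q :: 'a \<times> real. fst q \<noteq> 0 \<and> snd q - t \<in> I}"
  have "open {q :: 'a \<times> real. norm (fst q) < R'}" by (intro open_Collect_less continuous_intros)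
  then have "open ({q :: 'a \<times> real. norm (fst q) < R'} \<inter> ?S)"
    using smooth_on_neck(2)[OF I \<rho>_pos \<rho>' c'] by (rule open_Int)
  also have "{q :: 'a \<times> real. norm (fst q) < R'} \<inter> ?S = U" by (auto simp: U)
  finally have oU: "open U" .
  have US: "U \<subseteq> ?S" by (auto simp: U)
  define D where "D y = sqrt (1 + (c y)\<^sup>2)" for y
  have D: "D y > 0" for y unfolding D_def by (smt (verit) zero_le_power2 real_sqrt_gt_zero)
  have D2: "(c y)\<^sup>2 = (D y)\<^sup>2 - 1" for y by (simp add: D_def)
  have g: "grad F q = ((1 / norm (fst q)) *\<^sub>R fst q, - c (snd q - t))" if "q \<in> U" for q
  proof -
    have "(F has_derivative (\<lambda>h. 1 * (fst q \<bullet> fst h) / norm (fst q) - c (snd q - t) * snd h)) (at q)"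
      unfolding F using that US
      by (intro has_derivative_diff has_derivative_radial_fst has_derivative_snd_diff \<rho>' DERIV_ident) auto
    then show ?thesis by (intro grad_eqI) (simp add: inner_prod_def)
  qed
  have ng: "norm (grad F q) = D (snd q - t)" if "q \<in> U" for q
  proof -
    have "norm ((1 / norm (fst q)) *\<^sub>R fst q) = 1" using that by (simp add: U)
    then show ?thesis unfolding g[OF that] norm_prod_def by (simp add: D_def)
  qed
  let ?a = "\<lambda>q. 1 / norm (fst q) * (1 / D (snd q - t))" and ?b = "\<lambda>q. - (c (snd q - t) * (1 / D (snd q - t)))"
  define N where "N q = (?a q *\<^sub>R fst q, ?b q)" for q :: "'a \<times> real"
  have N: "unit_normal F q = N q" if "q \<in> U" for q
    unfolding unit_normal_def ng[OF that] unfolding g[OF that] N_def by (simp add: field_simps)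
  show "local_equation M U F"
    unfolding local_equation_def using oU US M g smooth_on_neck(1)[OF I \<rho>_pos \<rho>' c', of t]
    by (auto intro: smooth_on_subset simp: F U prod_eq_iff)
  define p where "p y = (1 + (c y)\<^sup>2) * (m / \<rho> y - c y)" for y
  define A where "A q h = 1 / norm (fst q) * (- (c (snd q - t) * p (snd q - t) / D (snd q - t) ^ 3) * snd h)
      + - (1 / (norm (fst q))\<^sup>2) * (fst q \<bullet> fst h) / norm (fst q) * (1 / D (snd q - t))" for q h :: "'a \<times> real"
  define B where "B q h = - (c (snd q - t) * (- (c (snd q - t) * p (snd q - t) / D (snd q - t) ^ 3) * snd h)
      + p (snd q - t) * snd h * (1 / D (snd q - t)))" for q h :: "'a \<times> real"
  have inv: "((\<lambda>\<rho>. 1 / \<rho>) has_real_derivative - (1 / \<rho>\<^sup>2)) (at \<rho>)" if "\<rho> \<noteq> 0" for \<rho> :: real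
    using that by (auto intro!: derivative_eq_intros simp: power2_eq_square)
  have A: "(?a has_derivative A q) (at q)" and B: "(?b has_derivative B q) (at q)" if "q \<in> U" for q
    unfolding A_def[abs_def] B_def[abs_def] p_def D_def using that US
    by (intro has_derivative_mult has_derivative_minus has_derivative_radial_fst has_derivative_snd_diff
        inv c' inverse_sqrt_one_plus_sq_deriv; auto)+
  have DN: "(N has_derivative (\<lambda>h. (?a q *\<^sub>R fst h + A q h *\<^sub>R fst q, B q h))) (at q)" if "q \<in> U" for q
    unfolding N_def by (intro has_derivative_Pair has_derivative_scaleR A B that has_derivative_fst has_derivative_ident)
  have DF: "(unit_normal F has_derivative (\<lambda>h. (?a q *\<^sub>R fst h + A q h *\<^sub>R fst q, B q h))) (at q)"
    if "q \<in> U" for q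
    by (rule has_derivative_unit_normal[OF oU that N DN[OF that]])
  show "divergence (unit_normal F) q = - ((0, 1) \<bullet> unit_normal F q)" if q: "q \<in> U" "q \<in> M" for q
  proof -
    let ?y = "snd q - t"
    \<comment> \<open>Membership in \<open>M\<close> enters here: it identifies the actual radius
      with the one in the equation for \<open>c\<close>.\<close>
    have \<rho>: "norm (fst q) = \<rho> ?y" using M q by simp
    have pos: "\<rho> ?y > 0" using q by (auto simp: U \<rho>_pos)
    have "divergence (unit_normal F) q = divergence N q"
      using divergence_eqI[OF DF[OF q(1)]] divergence_eqI[OF DN[OF q(1)]] by simp
    also have "\<dots> = A q (fst q, 0) + real DIM('a) * ?a q + B q (0, 1)"
      unfolding N_def by (rule divergence_radial_vertical[OF A[OF q(1)] B[OF q(1)]])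
    also have "A q (fst q, 0) = - ?a q"
      using pos D[of ?y] by (simp add: A_def \<rho> dot_square_norm power2_eq_square)
    also have "B q (0, 1) = p ?y * ((c ?y)\<^sup>2 - (D ?y)\<^sup>2) / D ?y ^ 3"
      using D[of ?y] by (simp add: B_def field_simps power2_eq_square power3_eq_cube)
    also have "\<dots> = - ((m / \<rho> ?y - c ?y) / D ?y)"
    proof -
      have "p ?y = (D ?y)\<^sup>2 * (m / \<rho> ?y - c ?y)" unfolding p_def D2 by simp
      moreover have "(c ?y)\<^sup>2 - (D ?y)\<^sup>2 = - 1" unfolding D2 by simp
      ultimately show ?thesis
        using D[of ?y] by (simp only:) (simp add: power2_eq_square power3_eq_cube)
    qed
    also have "- ?a q + real DIM('a) * ?a q + - ((m / \<rho> ?y - c ?y) / D ?y) = c ?y / D ?y"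
      using pos D[of ?y] by (simp add: \<rho> m field_simps)
    also have "\<dots> = - ((0, 1) \<bullet> N q)" by (simp add: N_def inner_prod_def)
    finally show ?thesis by (simp add: N q)
  qed
  show "unit_normal F q = ((1 / norm (fst q)) *\<^sub>R fst q, 0)" if "q \<in> U" "c (snd q - t) = 0" for q
    using that by (simp add: N N_def D_def)
  show "frechet_derivative (unit_normal F) (at q) h =
      ((1 / norm (fst q)) *\<^sub>R fst h - (fst q \<bullet> fst h / norm (fst q) ^ 3) *\<^sub>R fst q, - (m / \<rho> (snd q - t) * snd h))"
    if "q \<in> U" "c (snd q - t) = 0" for q h
    unfolding frechet_derivative_at[OF DF[OF that(1)], symmetric]
    using that by (simp add: A_def B_def D_def p_def power2_eq_square power3_eq_cube)
qed

section \<open>Completeness\<close>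

text \<open>The derivative of a valid path may be unbounded, so the fundamental theorem first holds
  only for the gauge integral. Finite length makes the derivative Lebesgue integrable; the two
  integrals then agree and the norm inequality applies.\<close>

lemma dist_le_path_length:
  fixes \<gamma> :: "real \<Rightarrow> 'a::euclidean_space"
  assumes "valid_path \<gamma>"
  shows "ennreal (dist (pathstart \<gamma>) (pathfinish \<gamma>)) \<le> path_length \<gamma>"
proof (cases "path_length \<gamma> = \<infinity>")
  case False
  obtain S D where S: "finite S" and cont: "continuous_on {0..1} \<gamma>"
    and D: "\<And>s. s \<in> {0..1} - S \<Longrightarrow> (\<gamma> has_vector_derivative D s) (at s)" "continuous_on ({0..1} - S) D"
    using assms unfolding valid_path_def piecewise_C1_differentiable_on_def C1_differentiable_on_def
    by blast
  define f where "f s = vector_derivative \<gamma> (at s)" for s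
  have f: "f s = D s" if "s \<in> {0..1} - S" for s
    unfolding f_def using D(1)[OF that] by (rule vector_derivative_at)
  \<comment> \<open>At the break points \<open>vector_derivative\<close> may be an arbitrary value.
    Setting the integrand to zero on this finite set gives measurability without changing the
    integral.\<close>
  define g where "g s = indicator ({0..1} - S) s *\<^sub>R f s" for s
  have "(f has_integral (\<gamma> 1 - \<gamma> 0)) {0..1}"
    using S D(1) cont f
    by (intro fundamental_theorem_of_calculus_interior_strong[where S = S]) auto
  then have "((\<lambda>s. if s \<in> {0..1} then f s else 0) has_integral (\<gamma> 1 - \<gamma> 0)) UNIV"
    by (simp only: has_integral_restrict_UNIV)
  then have I: "(g has_integral (\<gamma> 1 - \<gamma> 0)) UNIV"
    by (rule has_integral_spike_finite[OF S, rotated]) (auto simp: g_def indicator_def)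
  have "closed S" using S by (rule finite_imp_closed)
  then have "{0..1} - S \<in> sets borel" by auto
  moreover have "continuous_on ({0..1} - S) f"
    using D(2) by (rule continuous_on_eq) (simp add: f)
  ultimately have meas: "g \<in> borel_measurable lborel"
    unfolding g_def[abs_def] using borel_measurable_continuous_on_indicator by simp
  have "(\<integral>\<^sup>+ s. ennreal (norm (g s)) \<partial>lborel) \<le> path_length \<gamma>"
    unfolding path_length_def f_def[symmetric]
    by (intro nn_integral_mono) (auto simp: g_def indicator_def)
  moreover from this False have "(\<integral>\<^sup>+ s. ennreal (norm (g s)) \<partial>lborel) < \<infinity>"
    by (simp add: less_top top_unique)
  then have int: "integrable lborel g"
    by (intro integrableI_bounded meas)
  from has_integral_integral_lborel[OF int] I have "integral\<^sup>L lborel g = \<gamma> 1 - \<gamma> 0"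
    by (rule has_integral_unique)
  with integral_norm_bound_ennreal[OF int]
  have "ennreal (norm (\<gamma> 1 - \<gamma> 0)) \<le> (\<integral>\<^sup>+ s. ennreal (norm (g s)) \<partial>lborel)" by simp
  ultimately show ?thesis
    by (simp add: pathstart_def pathfinish_def dist_norm norm_minus_commute)
qed simp

text \<open>Ambient distance is at most intrinsic distance, so an intrinsic Cauchy sequence
  converges in the ambient space, and closedness keeps the limit in \<open>M\<close>.\<close>

lemma closed_imp_complete_hypersurface:
  assumes "smooth_hypersurface M" "closed M"
  shows "complete_hypersurface M"
  unfolding complete_hypersurface_def
proof (intro conjI allI impI assms(1))
  fix \<sigma> :: "nat \<Rightarrow> 'a"
  assume \<sigma>: "range \<sigma> \<subseteq> M \<and> (\<forall>\<epsilon>>0. \<exists>N. \<forall>i\<ge>N. \<forall>j\<ge>N. intrinsic_dist M (\<sigma> i) (\<sigma> j) < ennreal \<epsilon>)"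
  have dist_less: "dist p q < \<epsilon>" if less: "intrinsic_dist M p q < ennreal \<epsilon>" for p q \<epsilon>
  proof -
    obtain \<gamma> where \<gamma>: "valid_path \<gamma>" "pathstart \<gamma> = p" "pathfinish \<gamma> = q" "path_length \<gamma> < ennreal \<epsilon>"
      using less unfolding intrinsic_dist_def INF_less_iff by auto
    then have "ennreal (dist p q) < ennreal \<epsilon>"
      using dist_le_path_length[OF \<gamma>(1)] by (simp add: le_less_trans)
    then show ?thesis
      by (simp add: ennreal_less_iff)
  qed
  have "Cauchy \<sigma>"
  proof (rule metric_CauchyI)
    fix \<epsilon> :: real assume "\<epsilon> > 0"
    with \<sigma> obtain N where "\<forall>i\<ge>N. \<forall>j\<ge>N. intrinsic_dist M (\<sigma> i) (\<sigma> j) < ennreal \<epsilon>"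
      by blast
    then have "\<forall>i\<ge>N. \<forall>j\<ge>N. dist (\<sigma> i) (\<sigma> j) < \<epsilon>"
      using dist_less by blast
    then show "\<exists>N. \<forall>i\<ge>N. \<forall>j\<ge>N. dist (\<sigma> i) (\<sigma> j) < \<epsilon>" ..
  qed
  then obtain p where p: "\<sigma> \<longlonglongrightarrow> p"
    using Cauchy_convergent convergent_def by blast
  have "p \<in> M"
    using \<sigma> by (intro closed_sequentially[OF assms(2) _ p]) auto
  with p show "\<exists>p\<in>M. \<sigma> \<longlonglongrightarrow> p" by blast
qed

lemma closed_graph_over:
  fixes f :: "'a::metric_space \<Rightarrow> real"
  assumes "closed S" "continuous_on S f"
  shows "closed (graph_over S f)"
  unfolding closed_sequential_limits
proof (intro allI impI)
  fix \<sigma> l assume *: "(\<forall>n. \<sigma> n \<in> graph_over S f) \<and> \<sigma> \<longlonglongrightarrow> l"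
  have \<sigma>: "fst (\<sigma> n) \<in> S" "snd (\<sigma> n) = f (fst (\<sigma> n))" for n
    using conjunct1[OF *, rule_format, of n] by (auto simp: graph_over_def)
  have \<sigma>l: "\<sigma> \<longlonglongrightarrow> l" using * ..
  have lim: "(\<lambda>n. fst (\<sigma> n)) \<longlonglongrightarrow> fst l" "(\<lambda>n. f (fst (\<sigma> n))) \<longlonglongrightarrow> snd l"
    using tendsto_fst[OF \<sigma>l] tendsto_snd[OF \<sigma>l] by (simp_all add: \<sigma>(2))
  have "fst l \<in> S"
    using closed_sequentially[OF assms(1) \<sigma>(1) lim(1)] .
  moreover from this have "(\<lambda>n. f (fst (\<sigma> n))) \<longlonglongrightarrow> f (fst l)"
    using continuous_on_tendsto_compose[OF assms(2) lim(1)] \<sigma>(1) by simp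
  then have "snd l = f (fst l)" using lim(2) LIMSEQ_unique by blast
  ultimately show "l \<in> graph_over S f"
    unfolding graph_over_def by (intro image_eqI[of _ _ "fst l"]) (simp_all add: prod_eq_iff)
qed

section \<open>The winglike translator\<close>

text \<open>At \<open>s = 0\<close> the tangent is vertical, so \<open>z\<close> is a local
  diffeomorphism and its inverse turns the curve into a graph over the axis. The last clause is
  global: it excludes any other part of the curve from the region with height in \<open>I\<close>
  and radius below \<open>R'\<close>.\<close>

lemma neck_exists:
  fixes r z \<theta> :: "real \<Rightarrow> real"
  assumes m: "m > 0" and R: "R > 0" and init: "r 0 = R" "z 0 = 0" "\<theta> 0 = pi / 2"
    and r': "\<And>s. (r has_real_derivative cos (\<theta> s)) (at s)"
    and z': "\<And>s. (z has_real_derivative sin (\<theta> s)) (at s)"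
    and \<theta>': "\<And>s. (\<theta> has_real_derivative cos (\<theta> s) - m * sin (\<theta> s) / r s) (at s)"
    and pos: "\<And>s. s > 0 \<Longrightarrow> - pi / 2 < \<theta> s \<and> \<theta> s < pi / 2"
    and neg: "\<And>s. s < 0 \<Longrightarrow> pi / 2 < \<theta> s \<and> \<theta> s < 3 * pi / 2"
    and rR: "\<And>s. r s \<ge> R"
  shows "\<exists>I R' \<rho> c. open I \<and> 0 \<in> I \<and> R' > R \<and> c 0 = 0 \<and> (\<forall>y\<in>I. \<rho> y > 0) \<and>
    (\<forall>y\<in>I. (\<rho> has_real_derivative c y) (at y)) \<and>
    (\<forall>y\<in>I. (c has_real_derivative (1 + (c y)\<^sup>2) * (m / \<rho> y - c y)) (at y)) \<and>
    (\<forall>y\<in>I. \<forall>x<R'. (\<exists>s. x = r s \<and> y = z s) \<longleftrightarrow> x = \<rho> y)"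
proof -
  have r_cont: "continuous_on A r" and z_cont: "continuous_on A z" for A
    by (auto intro!: continuous_at_imp_continuous_on DERIV_isCont r' z')
  have inc: "r s < r t" if "0 \<le> s" "s < t" for s t
    using that pos
    by (intro DERIV_pos_imp_increasing_open[OF \<open>s < t\<close>])
      (auto intro!: exI[of _ "cos (\<theta> _)"] r' r_cont cos_gt_zero_pi)
  have dec: "r t < r s" if "s < t" "t \<le> 0" for s t
    using that neg
    by (intro DERIV_neg_imp_decreasing_open[OF \<open>s < t\<close>])
      (auto intro!: exI[of _ "cos (\<theta> _)"] r' r_cont cos_negative_between)
  obtain \<delta> where \<delta>: "\<delta> > 0" "\<And>s. \<bar>s\<bar> < \<delta> \<Longrightarrow> 0 < \<theta> s \<and> \<theta> s < pi"
  proof -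
    have "(\<theta> \<longlongrightarrow> pi / 2) (at 0)"
      using DERIV_isCont[OF \<theta>'[of 0]] by (simp add: isCont_def init)
    then have "eventually (\<lambda>s. \<theta> s > 0) (at 0)" "eventually (\<lambda>s. \<theta> s < pi) (at 0)"
      by (rule order_tendstoD; simp)+
    then have "eventually (\<lambda>s. 0 < \<theta> s \<and> \<theta> s < pi) (at 0)" by eventually_elim simp
    then obtain d where "d > 0" "\<And>s. s \<noteq> 0 \<Longrightarrow> \<bar>s\<bar> < d \<Longrightarrow> 0 < \<theta> s \<and> \<theta> s < pi"
      by (auto simp: eventually_at dist_real_def)
    then show thesis using that[of d] init by (metis pi_gt_zero pi_half_gt_zero pi_half_less_two field_sum_of_halves less_add_same_cancel1)
  qed
  have sin_pos: "sin (\<theta> s) > 0" if "\<bar>s\<bar> < \<delta>" for s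
    using \<delta>(2)[OF that] by (intro sin_gt_zero) auto
  define J where "J = {- \<delta><..<\<delta>}"
  have z_mono: "z s < z t" if "s \<in> J" "t \<in> J" "s < t" for s t
    using that sin_pos
    by (intro DERIV_pos_imp_increasing_open[OF \<open>s < t\<close>]) (auto intro!: exI[of _ "sin (\<theta> _)"] z' z_cont simp: J_def)
  have inj: "inj_on z J"
    using z_mono by (intro linorder_inj_onI') (force simp: less_le)
  obtain \<sigma> where \<sigma>: "homeomorphism J (z ` J) z \<sigma>"
    by (rule invariance_of_domain_homeomorphism[of J z]) (use inj z_cont in \<open>auto simp: J_def\<close>)
  define I where "I = z ` J"
  have I: "open I"
    unfolding I_def by (rule invariance_of_domain) (use inj z_cont in \<open>auto simp: J_def\<close>)
  have \<sigma>_J: "\<sigma> y \<in> J" and z_\<sigma>: "z (\<sigma> y) = y" if "y \<in> I" for y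
    using \<sigma> that by (auto simp: homeomorphism_def I_def)
  have \<sigma>_z: "\<sigma> (z s) = s" if "s \<in> J" for s
    using \<sigma> that by (auto simp: homeomorphism_def)
  have \<sigma>_sin: "sin (\<theta> (\<sigma> y)) > 0" if "y \<in> I" for y
    using \<sigma>_J[OF that] by (intro sin_pos) (auto simp: J_def)
  have \<sigma>': "(\<sigma> has_real_derivative inverse (sin (\<theta> (\<sigma> y)))) (at y)" if y: "y \<in> I" for y
  proof -
    obtain e where e: "e > 0" "ball y e \<subseteq> I" using I y openE by blast
    have sub: "x \<in> I" if "y - e < x" "x < y + e" for x
      using that e(2) by (auto simp: dist_real_def subset_iff)
    have "continuous_on I \<sigma>" using \<sigma> by (simp add: homeomorphism_def I_def)
    then have "isCont \<sigma> y" using I y continuous_on_eq_continuous_at by blast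
    then show ?thesis
      using \<sigma>_sin[OF y] e(1) z_\<sigma> sub
      by (intro DERIV_inverse_function[where f = z and a = "y - e" and b = "y + e"] z') auto
  qed
  define \<rho> where "\<rho> y = r (\<sigma> y)" for y
  \<comment> \<open>The cotangent of the angle, which is the derivative of the radius with respect
    to the height.\<close>
  define c where "c y = cos (\<theta> (\<sigma> y)) / sin (\<theta> (\<sigma> y))" for y
  have \<rho>_pos: "\<rho> y > 0" for y
    using rR[of "\<sigma> y"] R by (simp add: \<rho>_def)
  have \<rho>': "(\<rho> has_real_derivative c y) (at y)" if "y \<in> I" for y
    using DERIV_chain2[OF r' \<sigma>'[OF that]] by (simp add: \<rho>_def[abs_def] c_def field_simps)
  have c': "(c has_real_derivative (1 + (c y)\<^sup>2) * (m / \<rho> y - c y)) (at y)" if y: "y \<in> I" for y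
  proof -
    let ?C = "cos (\<theta> (\<sigma> y))" and ?S = "sin (\<theta> (\<sigma> y))"
    define T where "T = (?C - m * ?S / \<rho> y) * inverse ?S"
    have T: "((\<lambda>y. \<theta> (\<sigma> y)) has_real_derivative T) (at y)"
      unfolding T_def \<rho>_def by (rule DERIV_chain2[OF \<theta>' \<sigma>'[OF y]])
    have "(c has_real_derivative ((- ?S * T) * ?S - ?C * (?C * T)) / (?S * ?S)) (at y)"
      unfolding c_def[abs_def] using \<sigma>_sin[OF y]
      by (intro DERIV_divide DERIV_chain2[OF DERIV_cos T] DERIV_chain2[OF DERIV_sin T]) auto
    moreover have "((- ?S * T) * ?S - ?C * (?C * T)) / (?S * ?S) = - T * (1 + (c y)\<^sup>2)"
    proof -
      have "((- S * T) * S - C * (C * T)) / (S * S) = - T * (1 + (C / S)\<^sup>2)" if "S \<noteq> 0" for S C :: real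
        using that by (simp add: field_simps power2_eq_square)
      then show ?thesis using \<sigma>_sin[OF y] unfolding c_def by simp
    qed
    moreover have "- T = m / \<rho> y - c y"
      using \<sigma>_sin[OF y] \<rho>_pos[of y] by (simp add: T_def c_def field_simps)
    ultimately show ?thesis by (simp add: mult.commute)
  qed
  \<comment> \<open>The radius is monotone on each side of \<open>s = 0\<close>, so outside
    \<open>J\<close> it is at least its value at \<open>\<delta>\<close> or at
    \<open>- \<delta>\<close>. A smaller radius forces the parameter into \<open>J\<close>, where
    \<open>z\<close> is injective.\<close>
  define R' where "R' = min (r \<delta>) (r (- \<delta>))"
  have \<sigma>0: "\<sigma> 0 = 0" using \<sigma>_z[of 0] \<delta>(1) init by (simp add: J_def)
  have near: "s \<in> J" if "r s < R'" for s
  proof (rule ccontr)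
    assume "s \<notin> J"
    then consider "s = \<delta>" | "s > \<delta>" | "s = - \<delta>" | "s < - \<delta>" by (force simp: J_def)
    then show False
      using inc[of \<delta> s] dec[of s "- \<delta>"] \<delta>(1) that by cases (auto simp: R'_def)
  qed
  show ?thesis
  proof (intro exI conjI ballI allI impI)
    show "open I" by (rule I)
    show "0 \<in> I" unfolding I_def by (rule image_eqI[of _ _ 0]) (use init \<delta>(1) in \<open>auto simp: J_def\<close>)
    show "R' > R" using inc[of 0 \<delta>] dec[of "- \<delta>" 0] \<delta>(1) init by (simp add: R'_def)
    show "c 0 = 0" by (simp add: c_def \<sigma>0 init)
    show "(\<exists>s. x = r s \<and> y = z s) \<longleftrightarrow> x = \<rho> y" if "y \<in> I" "x < R'" for x y
      using near \<sigma>_z z_\<sigma>[OF that(1)] that(2) unfolding \<rho>_def by metis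
  qed (use \<rho>_pos \<rho>' c' in auto)
qed

text \<open>The last conclusion matches the two wings, near the neck, with the graph over the axis.
  It holds because all three parametrise pieces of the same curve.\<close>

lemma winglike_profile_exists:
  assumes m: "m > 0" and R: "R > 0"
  obtains w v \<phi> \<psi> \<rho> c I R' where
    "continuous_on {R..} w" "continuous_on {R..} v" "w R = 0" "v R = 0"
    "\<And>x. x > R \<Longrightarrow> (w has_real_derivative \<phi> x) (at x)"
    "\<And>x. x > R \<Longrightarrow> (\<phi> has_real_derivative (1 + (\<phi> x)\<^sup>2) * (1 - m * \<phi> x / x)) (at x)"
    "\<And>x. x > R \<Longrightarrow> (v has_real_derivative \<psi> x) (at x)"
    "\<And>x. x > R \<Longrightarrow> (\<psi> has_real_derivative (1 + (\<psi> x)\<^sup>2) * (1 - m * \<psi> x / x)) (at x)"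
    "filterlim \<phi> at_top (at_right R)" "filterlim \<psi> at_bot (at_right R)"
    "\<And>x. x > R \<Longrightarrow> w x > v x"
    "open I" "0 \<in> I" "R' > R" "c 0 = 0"
    "\<And>y. y \<in> I \<Longrightarrow> \<rho> y > 0"
    "\<And>y. y \<in> I \<Longrightarrow> (\<rho> has_real_derivative c y) (at y)"
    "\<And>y. y \<in> I \<Longrightarrow> (c has_real_derivative (1 + (c y)\<^sup>2) * (m / \<rho> y - c y)) (at y)"
    "\<And>x y. y \<in> I \<Longrightarrow> x < R' \<Longrightarrow> R \<le> x \<and> (y = w x \<or> y = v x) \<longleftrightarrow> x = \<rho> y"
proof -
  obtain r z \<theta> where init: "r 0 = R" "z 0 = 0" "\<theta> 0 = pi / 2"
    and r': "\<And>s. (r has_real_derivative cos (\<theta> s)) (at s)"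
    and z': "\<And>s. (z has_real_derivative sin (\<theta> s)) (at s)"
    and \<theta>': "\<And>s. (\<theta> has_real_derivative cos (\<theta> s) - m * sin (\<theta> s) / r s) (at s)"
    and pos: "\<And>s. s > 0 \<Longrightarrow> - pi / 2 < \<theta> s \<and> \<theta> s < pi / 2"
    and neg: "\<And>s. s < 0 \<Longrightarrow> pi / 2 < \<theta> s \<and> \<theta> s < 3 * pi / 2"
    and rR: "\<And>s. r s \<ge> R"
    using profile_curve_exists[OF m R] by metis
  obtain w \<phi> where w: "\<And>s. s \<ge> 0 \<Longrightarrow> w (r s) = z s" "\<And>x. x \<ge> R \<Longrightarrow> \<exists>s\<ge>0. r s = x"
    "continuous_on {R..} w"
    "\<And>x. x > R \<Longrightarrow> (w has_real_derivative \<phi> x) (at x)"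
    "\<And>x. x > R \<Longrightarrow> (\<phi> has_real_derivative (1 + (\<phi> x)\<^sup>2) * (1 - m * \<phi> x / x)) (at x)"
    "filterlim \<phi> at_top (at_right R)"
    using wing_exists[OF m R r' z' \<theta>' pos rR init(1)] init(3) by metis
  have mirror: "((\<lambda>s. f (- s)) has_real_derivative - d (- s)) (at s)"
    if "\<And>s. (f has_real_derivative d s) (at s)" for f d :: "real \<Rightarrow> real" and s
    using DERIV_chain2[OF that DERIV_minus[OF DERIV_ident], of s] by simp
  have mr: "((\<lambda>s. r (- s)) has_real_derivative cos (\<theta> (- s) - pi)) (at s)"
    and mz: "((\<lambda>s. z (- s)) has_real_derivative sin (\<theta> (- s) - pi)) (at s)"
    and m\<theta>: "((\<lambda>s. \<theta> (- s) - pi) has_real_derivative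
      cos (\<theta> (- s) - pi) - m * sin (\<theta> (- s) - pi) / r (- s)) (at s)" for s
    using mirror[OF r', of s] mirror[OF z', of s] DERIV_diff[OF mirror[OF \<theta>', of s] DERIV_const[of pi]]
    by (simp_all add: cos_diff sin_diff)
  have mpos: "- pi / 2 < \<theta> (- s) - pi \<and> \<theta> (- s) - pi < pi / 2" if "s > 0" for s
    using neg[of "- s"] that by simp
  obtain v \<psi> where v: "\<And>s. s \<ge> 0 \<Longrightarrow> v (r (- s)) = z (- s)" "\<And>x. x \<ge> R \<Longrightarrow> \<exists>s\<ge>0. r (- s) = x"
    "continuous_on {R..} v"
    "\<And>x. x > R \<Longrightarrow> (v has_real_derivative \<psi> x) (at x)"
    "\<And>x. x > R \<Longrightarrow> (\<psi> has_real_derivative (1 + (\<psi> x)\<^sup>2) * (1 - m * \<psi> x / x)) (at x)"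
    "filterlim \<psi> at_bot (at_right R)"
    using wing_exists[OF m R mr mz m\<theta> mpos rR] init by (auto simp: field_simps)
  obtain I R' \<rho> c where neck: "open I" "0 \<in> I" "R' > R" "c 0 = 0" "\<forall>y\<in>I. \<rho> y > 0"
    "\<forall>y\<in>I. (\<rho> has_real_derivative c y) (at y)"
    "\<forall>y\<in>I. (c has_real_derivative (1 + (c y)\<^sup>2) * (m / \<rho> y - c y)) (at y)"
    "\<forall>y\<in>I. \<forall>x<R'. (\<exists>s. x = r s \<and> y = z s) \<longleftrightarrow> x = \<rho> y"
    using neck_exists[OF m R init r' z' \<theta>' pos neg rR] by blast
  have curve: "R \<le> x \<and> (y = w x \<or> y = v x) \<longleftrightarrow> (\<exists>s. x = r s \<and> y = z s)" for x y
  proof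
    assume "R \<le> x \<and> (y = w x \<or> y = v x)"
    then show "\<exists>s. x = r s \<and> y = z s" using w(1,2) v(1,2) by metis
  next
    assume "\<exists>s. x = r s \<and> y = z s"
    then obtain s where s: "x = r s" "y = z s" by blast
    then show "R \<le> x \<and> (y = w x \<or> y = v x)"
      using rR[of s] w(1)[of s] v(1)[of "- s"] by (cases "s \<ge> 0") auto
  qed
  have R0: "w R = 0" "v R = 0" using w(1)[of 0] v(1)[of 0] init by auto
  show thesis
    by (rule that[OF w(3) v(3) R0 w(4,5) v(4,5) w(6) v(6) _ neck(1-4) neck(5-7)[rule_format]])
      (use wings_ordered[OF R w(3-5) v(3-5) w(6) v(6)] R0 neck(8) in \<open>simp_all add: curve\<close>)
qed

text \<open>The blow-up is assumed for the absolute value of the slope so that both wings qualify,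
  one with slope tending to plus infinity and one to minus infinity.\<close>

lemma wing_properties:
  fixes w \<phi> :: "real \<Rightarrow> real"
  assumes R: "R > 0" and m: "m = real DIM('a::euclidean_space) - 1"
    and w: "continuous_on {R..} w"
    and w': "\<And>\<rho>. \<rho> > R \<Longrightarrow> (w has_real_derivative \<phi> \<rho>) (at \<rho>)"
    and \<phi>': "\<And>\<rho>. \<rho> > R \<Longrightarrow> (\<phi> has_real_derivative (1 + (\<phi> \<rho>)\<^sup>2) * (1 - m * \<phi> \<rho> / \<rho>)) (at \<rho>)"
    and lim: "filterlim (\<lambda>\<rho>. \<bar>\<phi> \<rho>\<bar>) at_top (at_right R)"
    and asymp: "\<And>\<rho>. \<rho> \<ge> b \<Longrightarrow> \<bar>w \<rho> - (\<rho>\<^sup>2 / (2 * m) - ln \<rho> + C)\<bar> \<le> K / \<rho>"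
  defines "W \<equiv> (\<lambda>(x :: 'a) t. w (norm x) + t)"
  shows "continuous_on ({x. norm x \<ge> R} \<times> {0..}) (\<lambda>(x, t). W x t)"
    and "rotationally_symmetric_on {x. norm x \<ge> R} W"
    and "translating_with_unit_speed_on {x. norm x \<ge> R} W"
    and "graphical_mcf_on {x. norm x > R} W"
    and "LIM x filtercomap norm (at_right R). norm (grad (\<lambda>y. W y t) x) :> at_top"
    and "(\<lambda>x. W x t - (t + (norm x)\<^sup>2 / (2 * m) - ln (norm x) + C)) \<in> O[at_infinity](\<lambda>x. 1 / norm x)"
proof -
  show "continuous_on ({x. norm x \<ge> R} \<times> {0..}) (\<lambda>(x, t). W x t)"
    unfolding W_def case_prod_unfold
    by (intro continuous_intros continuous_on_compose2[OF w]) auto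
  show "rotationally_symmetric_on {x. norm x \<ge> R} W" "translating_with_unit_speed_on {x. norm x \<ge> R} W"
    by (auto simp: rotationally_symmetric_on_def translating_with_unit_speed_on_def W_def)
  show "graphical_mcf_on {x. norm x > R} W"
    unfolding W_def by (rule wing_graphical_mcf(1)[OF R m w' \<phi>'])
  have "eventually (\<lambda>x :: 'a. norm x > R) (filtercomap norm (at_right R))"
    by (rule eventually_filtercomapI) (simp add: eventually_at_right_less)
  then have "eventually (\<lambda>x. \<bar>\<phi> (norm x)\<bar> = norm (grad (\<lambda>y. W y t) x)) (filtercomap norm (at_right R))"
    by eventually_elim (simp only: W_def wing_graphical_mcf(2)[OF R m w' \<phi>'])
  moreover have "LIM x filtercomap norm (at_right R). \<bar>\<phi> (norm (x :: 'a))\<bar> :> at_top"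
    by (rule filterlim_compose[OF lim filterlim_filtercomap])
  ultimately show "LIM x filtercomap norm (at_right R). norm (grad (\<lambda>y. W y t) x) :> at_top"
    by (simp cong: filterlim_cong)
  show "(\<lambda>x. W x t - (t + (norm x)\<^sup>2 / (2 * m) - ln (norm x) + C)) \<in> O[at_infinity](\<lambda>x. 1 / norm x)"
  proof (rule bigoI[where c = K])
    have "norm (W x t - (t + (norm x)\<^sup>2 / (2 * m) - ln (norm x) + C)) \<le> K * norm (1 / norm x)"
      if "b \<le> norm x" for x
      using asymp[OF that] by (simp add: W_def algebra_simps)
    then show "\<forall>\<^sub>F x in at_infinity. norm (W x t - (t + (norm x)\<^sup>2 / (2 * m) - ln (norm x) + C))
        \<le> K * norm (1 / norm x)"
      unfolding eventually_at_infinity by blast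
  qed
qed

section \<open>The hypersurface generated by the profile\<close>

locale winglike_profile =
  fixes m R R' :: real and w v \<phi> \<psi> \<rho> c :: "real \<Rightarrow> real" and I :: "real set"
  assumes R: "R > 0"
    and w_cont: "continuous_on {R..} w" and v_cont: "continuous_on {R..} v"
    and w_R: "w R = 0" and v_R: "v R = 0"
    and w': "\<And>x. x > R \<Longrightarrow> (w has_real_derivative \<phi> x) (at x)"
    and \<phi>': "\<And>x. x > R \<Longrightarrow> (\<phi> has_real_derivative (1 + (\<phi> x)\<^sup>2) * (1 - m * \<phi> x / x)) (at x)"
    and v': "\<And>x. x > R \<Longrightarrow> (v has_real_derivative \<psi> x) (at x)"
    and \<psi>': "\<And>x. x > R \<Longrightarrow> (\<psi> has_real_derivative (1 + (\<psi> x)\<^sup>2) * (1 - m * \<psi> x / x)) (at x)"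
    and above: "\<And>x. x > R \<Longrightarrow> w x > v x"
    and I: "open I" "0 \<in> I" and R': "R' > R" and c0: "c 0 = 0"
    and \<rho>_pos: "\<And>y. y \<in> I \<Longrightarrow> \<rho> y > 0"
    and \<rho>': "\<And>y. y \<in> I \<Longrightarrow> (\<rho> has_real_derivative c y) (at y)"
    and c': "\<And>y. y \<in> I \<Longrightarrow> (c has_real_derivative (1 + (c y)\<^sup>2) * (m / \<rho> y - c y)) (at y)"
    and neck: "\<And>x y. y \<in> I \<Longrightarrow> x < R' \<Longrightarrow> R \<le> x \<and> (y = w x \<or> y = v x) \<longleftrightarrow> x = \<rho> y"
begin

definition hypersurface :: "real \<Rightarrow> ('a::euclidean_space \<times> real) set" where
  "hypersurface t = graph_over {x. norm x \<ge> R} (\<lambda>x. w (norm x) + t) \<union>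
     graph_over {x. norm x \<ge> R} (\<lambda>x. v (norm x) + t)"

text \<open>The axis is removed because the norm is not differentiable at the origin.\<close>

definition neck_domain :: "real \<Rightarrow> ('a::euclidean_space \<times> real) set" where
  "neck_domain t = {q. fst q \<noteq> 0 \<and> norm (fst q) < R' \<and> snd q - t \<in> I}"

lemma mem_hypersurface:
  "q \<in> hypersurface t \<longleftrightarrow>
     R \<le> norm (fst q) \<and> (snd q - t = w (norm (fst q)) \<or> snd q - t = v (norm (fst q)))"
  by (cases q) (auto simp: hypersurface_def graph_over_def image_iff)

lemma mem_hypersurface_neck:
  "q \<in> neck_domain t \<Longrightarrow> q \<in> hypersurface t \<longleftrightarrow> norm (fst q) = \<rho> (snd q - t)"
  unfolding mem_hypersurface neck_domain_def by (intro neck) auto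

text \<open>Beyond radius \<open>R\<close> the strict inequality \<open>above\<close> puts
  \<open>p\<close> on exactly one wing, hence in the chart from which the other graph is deleted. At
  radius \<open>R\<close> the wings meet at relative height 0, inside the neck chart.\<close>

lemma translator_chart:
  fixes p :: "'a::euclidean_space \<times> real"
  assumes m: "m = real DIM('a) - 1" and p: "p \<in> hypersurface t"
  shows "\<exists>U F. p \<in> U \<and> local_equation (hypersurface t) U F \<and>
    divergence (unit_normal F) p = - ((0, 1) \<bullet> unit_normal F p)"
proof -
  let ?\<rho> = "norm (fst p)" and ?M = "hypersurface t :: ('a \<times> real) set"
  consider (upper) "?\<rho> > R" "snd p - t = w ?\<rho>" | (lower) "?\<rho> > R" "snd p - t = v ?\<rho>" |
    (neck) "?\<rho> = R" "snd p - t = 0"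
    using p[unfolded mem_hypersurface] w_R v_R by (metis order_le_less)
  then show ?thesis
  proof cases
    case upper
    let ?U = "{q :: 'a \<times> real. norm (fst q) > R \<and> snd q - t \<noteq> v (norm (fst q))}"
    have M: "q \<in> ?M \<longleftrightarrow> snd q - t = w (norm (fst q))" if "q \<in> ?U" for q
      using that by (auto simp: mem_hypersurface)
    have pU: "p \<in> ?U" using upper above[of ?\<rho>] by auto
    show ?thesis
      by (intro exI conjI, rule pU) (rule wing_chart[OF R m w' \<phi>' v_cont refl refl M] pU; assumption?)+
  next
    case lower
    let ?U = "{q :: 'a \<times> real. norm (fst q) > R \<and> snd q - t \<noteq> w (norm (fst q))}"
    have M: "q \<in> ?M \<longleftrightarrow> snd q - t = v (norm (fst q))" if "q \<in> ?U" for q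
      using that by (auto simp: mem_hypersurface)
    have pU: "p \<in> ?U" using lower above[of ?\<rho>] by auto
    show ?thesis
      by (intro exI conjI, rule pU) (rule wing_chart[OF R m v' \<psi>' w_cont refl refl M] pU; assumption?)+
  next
    case neck
    then have pU: "p \<in> neck_domain t" using R R' I by (auto simp: neck_domain_def)
    show ?thesis
      by (intro exI conjI, rule pU)
        (rule neck_chart(1,2)[OF m I(1) \<rho>_pos \<rho>' c' neck_domain_def refl mem_hypersurface_neck] p pU; assumption?)+
  qed
qed

lemma smooth_hypersurface_hypersurface:
  assumes "m = real DIM('a::euclidean_space) - 1"
  shows "smooth_hypersurface (hypersurface t :: ('a \<times> real) set)"
  unfolding smooth_hypersurface_def using translator_chart[OF assms] by blast

lemma translating_mcf_solution_hypersurface: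
  assumes "m = real DIM('a::euclidean_space) - 1"
  shows "translating_mcf_solution (hypersurface :: real \<Rightarrow> ('a \<times> real) set)"
  unfolding translating_mcf_solution_def
proof (intro conjI allI impI ballI smooth_hypersurface_hypersurface assms)
  fix t :: real
  show "hypersurface t = (\<lambda>p :: 'a \<times> real. p + t *\<^sub>R (0, 1)) ` hypersurface 0"
    by (auto simp: hypersurface_def graph_over_def image_Un image_image)
next
  fix p :: "'a \<times> real"
  assume "p \<in> hypersurface 0"
  then show "\<exists>H. has_mean_curvature_vector (hypersurface 0) p H \<and>
      is_normal_component (hypersurface 0) p (0, 1) H"
    using translator_chart[OF assms] translator_equation_at by blast
qed

lemma complete_hypersurface_hypersurface:
  assumes "m = real DIM('a::euclidean_space) - 1"
  shows "complete_hypersurface (hypersurface t :: ('a \<times> real) set)"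
proof (rule closed_imp_complete_hypersurface[OF smooth_hypersurface_hypersurface[OF assms]])
  have "closed {x :: 'a. R \<le> norm x}"
    by (intro closed_Collect_le continuous_intros)
  then show "closed (hypersurface t :: ('a \<times> real) set)"
    unfolding hypersurface_def
    by (intro closed_Un closed_graph_over continuous_intros continuous_on_compose2[OF w_cont]
        continuous_on_compose2[OF v_cont]) auto
qed

text \<open>At the neck the principal curvatures in the vertical direction and along the sphere have
  opposite signs.\<close>

lemma not_convex_hypersurface:
  assumes m: "m = real DIM('a::euclidean_space) - 1" and dim: "DIM('a) \<ge> 2"
  shows "\<not> convex_hypersurface (hypersurface t :: ('a \<times> real) set)"
proof
  assume convex: "convex_hypersurface (hypersurface t :: ('a \<times> real) set)"
  obtain b :: 'a where "b \<in> Basis" using nonempty_Basis by blast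
  define x where "x = R *\<^sub>R b"
  have norm_x: "norm x = R" using R \<open>b \<in> Basis\<close> by (simp add: x_def)
  \<comment> \<open>Dimension at least 2 leaves room for a horizontal direction \<open>k\<close>
    orthogonal to \<open>x\<close>, that is, tangent to the sphere through \<open>x\<close>.\<close>
  have "dim {x} < DIM('a)" using dim by simp
  then obtain k where k: "k \<noteq> 0" "\<And>y. y \<in> span {x} \<Longrightarrow> orthogonal k y"
    using orthogonal_to_subspace_exists by blast
  have kx: "x \<bullet> k = 0"
    using k(2)[of x] by (simp add: span_base orthogonal_def inner_commute)
  let ?p = "(x, t)" and ?F = "\<lambda>q :: 'a \<times> real. norm (fst q) - \<rho> (snd q - t)"
  have p: "?p \<in> hypersurface t" by (simp add: mem_hypersurface norm_x w_R)
  have pU: "?p \<in> neck_domain t" using norm_x R R' I by (auto simp: neck_domain_def)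
  have c: "c (snd ?p - t) = 0" by (simp add: c0)
  note chart = neck_chart[OF m I(1) \<rho>_pos \<rho>' c' neck_domain_def refl mem_hypersurface_neck]
  have eq: "local_equation (hypersurface t) (neck_domain t) ?F"
    by (rule chart(1))
  have N: "unit_normal ?F ?p = ((1 / R) *\<^sub>R x, 0)"
    using chart(3)[OF _ _ _ _ pU c] by (simp add: norm_x)
  have dN: "frechet_derivative (unit_normal ?F) (at ?p) h =
      ((1 / R) *\<^sub>R fst h - (x \<bullet> fst h / R ^ 3) *\<^sub>R x, - (m / \<rho> 0 * snd h))" for h
    using chart(4)[OF _ _ _ _ pU c] by (simp add: norm_x)
  \<comment> \<open>The two values are \<open>- m / \<rho> 0\<close> in the vertical direction and
    \<open>(k \<bullet> k) / R\<close> along the sphere. Both directions are tangent because the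
    normal at the waist is horizontal and radial.\<close>
  have "second_fundamental_form ?F ?p (0, 1) (0, 1) < 0"
    using dim \<rho>_pos[OF I(2)] by (simp add: second_fundamental_form_def dN inner_prod_def m)
  moreover have "second_fundamental_form ?F ?p (k, 0) (k, 0) > 0"
    using k(1) R by (simp add: second_fundamental_form_def dN inner_prod_def kx)
  moreover have "(0, 1) \<bullet> unit_normal ?F ?p = 0" "(k, 0) \<bullet> unit_normal ?F ?p = 0"
    using kx by (simp_all add: N inner_prod_def inner_commute)
  ultimately show False
    using convex p pU eq unfolding convex_hypersurface_def by (meson not_less)
qed

end

theorem lemma2p3:
  fixes R :: real
  assumes "CARD('n::finite) \<ge> 2" and "R > 0"
  shows "\<exists>(Wp :: real ^ 'n \<Rightarrow> real \<Rightarrow> real) (Wm :: real ^ 'n \<Rightarrow> real \<Rightarrow> real) (Cp :: real) (Cm :: real).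
    (\<forall>(W, C) \<in> {(Wp, Cp), (Wm, Cm)}.
       continuous_on ({x. norm x \<ge> R} \<times> {0..}) (\<lambda>(x, t). W x t) \<and>
       rotationally_symmetric_on {x. norm x \<ge> R} W \<and>
       translating_with_unit_speed_on {x. norm x \<ge> R} W \<and>
       graphical_mcf_on {x. norm x > R} W \<and>
       (\<forall>t\<ge>0. LIM x filtercomap norm (at_right R). norm (grad (\<lambda>y. W y t) x) :> at_top) \<and>
       (\<forall>t\<ge>0. (\<lambda>x. W x t - (t + (norm x)\<^sup>2 / (2 * (real CARD('n) - 1)) - ln (norm x) + C))
                 \<in> O[at_infinity](\<lambda>x. 1 / norm x))) \<and>
    (\<forall>x. norm x = R \<longrightarrow> (\<forall>t\<ge>0. Wp x t = Wm x t)) \<and>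
    (let M = (\<lambda>t. graph_over {x. norm x \<ge> R} (\<lambda>x. Wp x t) \<union>
                  graph_over {x. norm x \<ge> R} (\<lambda>x. Wm x t))
     in translating_mcf_solution M \<and>
        (\<forall>t\<ge>0. complete_hypersurface (M t) \<and> \<not> convex_hypersurface (M t)))"
proof -
  define m where "m = real CARD('n) - 1"
  have m: "m \<ge> 1" "m > 0" "m = real DIM(real ^ 'n) - 1" using assms(1) by (auto simp: m_def)
  obtain w v \<phi> \<psi> \<rho> c I R' where profile:
    "continuous_on {R..} w" "continuous_on {R..} v" "w R = 0" "v R = 0"
    "\<And>x. x > R \<Longrightarrow> (w has_real_derivative \<phi> x) (at x)"
    "\<And>x. x > R \<Longrightarrow> (\<phi> has_real_derivative (1 + (\<phi> x)\<^sup>2) * (1 - m * \<phi> x / x)) (at x)"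
    "\<And>x. x > R \<Longrightarrow> (v has_real_derivative \<psi> x) (at x)"
    "\<And>x. x > R \<Longrightarrow> (\<psi> has_real_derivative (1 + (\<psi> x)\<^sup>2) * (1 - m * \<psi> x / x)) (at x)"
    and lim: "filterlim \<phi> at_top (at_right R)" "filterlim \<psi> at_bot (at_right R)"
    and wing_neck: "\<And>x. x > R \<Longrightarrow> w x > v x"
    "open I" "0 \<in> I" "R' > R" "c 0 = 0"
    "\<And>y. y \<in> I \<Longrightarrow> \<rho> y > 0"
    "\<And>y. y \<in> I \<Longrightarrow> (\<rho> has_real_derivative c y) (at y)"
    "\<And>y. y \<in> I \<Longrightarrow> (c has_real_derivative (1 + (c y)\<^sup>2) * (m / \<rho> y - c y)) (at y)"
    "\<And>x y. y \<in> I \<Longrightarrow> x < R' \<Longrightarrow> R \<le> x \<and> (y = w x \<or> y = v x) \<longleftrightarrow> x = \<rho> y"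
    by (rule winglike_profile_exists[OF m(2) assms(2)]) blast
  interpret winglike_profile m R R' w v \<phi> \<psi> \<rho> c I
    by unfold_locales (fact assms profile wing_neck)+
  obtain Cp Kp bp where Cp: "\<And>r. r \<ge> bp \<Longrightarrow> \<bar>w r - (r\<^sup>2 / (2 * m) - ln r + Cp)\<bar> \<le> Kp / r"
    using translator_height_asymptotics[OF m(1) R w' \<phi>'] by blast
  obtain Cm Km bm where Cm: "\<And>r. r \<ge> bm \<Longrightarrow> \<bar>v r - (r\<^sup>2 / (2 * m) - ln r + Cm)\<bar> \<le> Km / r"
    using translator_height_asymptotics[OF m(1) R v' \<psi>'] by blast
  have "filterlim (\<lambda>\<rho>. \<bar>\<phi> \<rho>\<bar>) at_top (at_right R)" "filterlim (\<lambda>\<rho>. \<bar>\<psi> \<rho>\<bar>) at_top (at_right R)"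
    using filterlim_compose[OF filterlim_abs_real lim(1)]
      filterlim_compose[OF filterlim_abs_real filterlim_compose[OF filterlim_uminus_at_top_at_bot lim(2)]]
    by simp_all
  note wing_w = wing_properties[OF R m(3) w_cont w' \<phi>' this(1) Cp, unfolded m_def]
    and wing_v = wing_properties[OF R m(3) v_cont v' \<psi>' this(2) Cm, unfolded m_def]
  show ?thesis
  proof (intro exI conjI)
    show "\<forall>(W, C) \<in> {((\<lambda>x :: real ^ 'n. \<lambda>t. w (norm x) + t), Cp), ((\<lambda>x. \<lambda>t. v (norm x) + t), Cm)}.
       continuous_on ({x. norm x \<ge> R} \<times> {0..}) (\<lambda>(x, t). W x t) \<and>
       rotationally_symmetric_on {x. norm x \<ge> R} W \<and>
       translating_with_unit_speed_on {x. norm x \<ge> R} W \<and>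
       graphical_mcf_on {x. norm x > R} W \<and>
       (\<forall>t\<ge>0. LIM x filtercomap norm (at_right R). norm (grad (\<lambda>y. W y t) x) :> at_top) \<and>
       (\<forall>t\<ge>0. (\<lambda>x. W x t - (t + (norm x)\<^sup>2 / (2 * (real CARD('n) - 1)) - ln (norm x) + C))
                 \<in> O[at_infinity](\<lambda>x. 1 / norm x))"
      unfolding ball_simps prod.case by (intro conjI allI impI TrueI wing_w wing_v)
    show "\<forall>x :: real ^ 'n. norm x = R \<longrightarrow> (\<forall>t\<ge>0. w (norm x) + t = v (norm x) + t)"
      by (simp add: w_R v_R)
    show "let M = (\<lambda>t. graph_over {x :: real ^ 'n. norm x \<ge> R} (\<lambda>x. w (norm x) + t) \<union>
                  graph_over {x. norm x \<ge> R} (\<lambda>x. v (norm x) + t))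
     in translating_mcf_solution M \<and>
        (\<forall>t\<ge>0. complete_hypersurface (M t) \<and> \<not> convex_hypersurface (M t))"
      unfolding Let_def hypersurface_def[symmetric]
      using translating_mcf_solution_hypersurface[OF m(3)] complete_hypersurface_hypersurface[OF m(3)]
        not_convex_hypersurface[OF m(3)] assms(1) by simp
  qed
qed

end
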